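(* Let $\mathbb{K}=\mathbb{R}$ or $\mathbb{C}$, fix the kind of scalar product (bilinear or sesquilinear), let $m\le n$, let $M\in\mathbb{K}^{m\times m}$ and $N\in\mathbb{K}^{n\times n}$ be nonsingular matrices, and let $\sigma:\mathbb{K}^{m\times m}\to\mathbb{K}^{m\times m}$ be a generalized matrix sign function. A rectangular matrix $F\in\mathbb{K}^{m\times n}$ has a decomposition $$F=SW,$$ where, with $\Sigma=\sigma(FF^{[M,N]})$, the matrix $S\in\mathbb{K}^{m\times m}$ is $r$-positive-definite, $M$-selfadjoint and $M\Sigma$-selfadjoint, and the matrix $W\in\mathbb{K}^{m\times n}$ has $(M\Sigma,N)$-orthonormal rows and satisfies $(W^{[M,N]})^{[N,M]}=W$, if and only if $FF^{[M,N]}$ is nonsingular and $(F^{[M,N]})^{[N,M]}=F$. When such a decomposition exists it is unique, with $S$ given by $S=(\Sigma FF^{[M,N]})^{1/2}$ (principal square root) and $W=S^{-1}F$.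
   Context: Notation. $A^\#=A^T$ if the scalar products are (real or complex) bilinear forms, and $A^\#=\bar A^T$ if they are sesquilinear forms; the same choice is used throughout for all scalar products. For nonsingular $M\in\mathbb{K}^{m\times m}$, $N\in\mathbb{K}^{n\times n}$ and $A\in\mathbb{K}^{m\times n}$, the $(M,N)$-adjoint is $A^{[M,N]}=N^{-1}A^\# M\in\mathbb{K}^{n\times m}$; correspondingly, for $B\in\mathbb{K}^{n\times m}$, $B^{[N,M]}=M^{-1}B^\# N$. For $A\in\mathbb{K}^{m\times m}$, $A^{[M]}=M^{-1}A^\# M$, and $A$ is $M$-selfadjoint if $A^{[M]}=A$, i.e. $A^\# M=MA$ (the same definition is used with $M$ replaced by any nonsingular matrix, e.g. $M\Sigma$). A square matrix is $r$-positive-definite if all of its eigenvalues have positive real part. A matrix $W\in\mathbb{K}^{m\times n}$ has $(M,N)$-orthonormal rows if $WW^{[M,N]}=I_m$, equivalently $M^{-1}=WN^{-1}W^\#$ (and likewise with $M$ replaced by any nonsingular matrix, e.g. $M\Sigma$). For a matrix $A$ with no eigenvalues in $(-\infty,0]$, $A^{1/2}$ is the principal square root: the unique square root of $A$ whose eigenvalues all lie in the open right half-plane. Primary matrix functions. A stem function $f$ assigns to each $\lambda$ in its domain in $\mathbb{C}$ a value $f(\lambda)=f^{(0)}(\lambda)$ and "derivative" values $f^{(j)}(\lambda)$, $j\ge1$, which may be arbitrarily assigned numbers at each $\lambda$. The associated primary matrix function is $f(A)=Qf(J)Q^{-1}$, where $A=QJQ^{-1}$ is a (complex) Jordan decomposition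 and $f$ is applied to each Jordan block: $f(J_s(\lambda))$ is the $s\times s$ upper triangular Toeplitz matrix with $f^{(j)}(\lambda)/j!$ on the $j$-th superdiagonal, $0\le j\le s-1$. A generalized matrix sign function $\sigma:\mathbb{K}^{m\times m}\to\mathbb{K}^{m\times m}$ is a primary matrix function such that for all nonsingular $A\in\mathbb{K}^{m\times m}$: $\sigma(A)A$ has no eigenvalues on the negative real axis, $\sigma(\bar A)=\overline{\sigma(A)}$, and all eigenvalues $\lambda$ of $\sigma(A)$ satisfy $|\lambda|=1$. Such $\sigma$ is defined on nonsingular matrices only (the stem function is left undefined at $0$); any statement that a decomposition involving $\Sigma=\sigma(\cdot)$ exists includes that $\Sigma$ is defined. *)

theory Defs
  imports
    Complex_Main
    "Jordan_Normal_Form.Gauss_Jordan_Elimination"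
    "Jordan_Normal_Form.Jordan_Normal_Form"
begin

text \<open>
  Matrices over the real or the complex field are both represented by complex matrices; the
  scalar field is a parameter \<open>K\<close> that is either \<open>\<real>\<close> or \<open>UNIV\<close>. Eigenvalues and Jordan
  decompositions of real matrices are the complex ones.
\<close>

definition mats_over :: "complex set \<Rightarrow> nat \<Rightarrow> nat \<Rightarrow> complex mat set" where
  "mats_over K m n = {A \<in> carrier_mat m n. elements_mat A \<subseteq> K}"

definition conj_mat :: "complex mat \<Rightarrow> complex mat" where
  "conj_mat A = map_mat cnj A"

text \<open>Meaningful for nonsingular square matrices only.\<close>

definition mat_inv :: "complex mat \<Rightarrow> complex mat" where
  "mat_inv A = the (mat_inverse A)"

datatype form_kind = Bilinear | Sesquilinear

fun sharp :: "form_kind \<Rightarrow> complex mat \<Rightarrow> complex mat" where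
  "sharp Bilinear A = transpose_mat A"
| "sharp Sesquilinear A = transpose_mat (conj_mat A)"

text \<open>The \<open>(M,N)\<close>-adjoint of an \<open>m \<times> n\<close> matrix, where \<open>M\<close> is \<open>m \<times> m\<close> and \<open>N\<close> is \<open>n \<times> n\<close>.\<close>

definition adjoint :: "form_kind \<Rightarrow> complex mat \<Rightarrow> complex mat \<Rightarrow> complex mat \<Rightarrow> complex mat" where
  "adjoint s M N A = mat_inv N * sharp s A * M"

definition selfadjoint :: "form_kind \<Rightarrow> complex mat \<Rightarrow> complex mat \<Rightarrow> bool" where
  "selfadjoint s M A \<longleftrightarrow> adjoint s M M A = A"

definition orthonormal_rows ::
  "form_kind \<Rightarrow> complex mat \<Rightarrow> complex mat \<Rightarrow> complex mat \<Rightarrow> bool" where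
  "orthonormal_rows s M N W \<longleftrightarrow> W * adjoint s M N W = 1\<^sub>m (dim_row W)"

definition r_positive_definite :: "complex mat \<Rightarrow> bool" where
  "r_positive_definite A \<longleftrightarrow> square_mat A \<and> (\<forall>z. eigenvalue A z \<longrightarrow> Re z > 0)"

text \<open>The principal square root; meaningful for square matrices \<open>A\<close> without eigenvalues
  in \<open>(-\<infinity>,0]\<close>.\<close>

definition principal_sqrt :: "complex mat \<Rightarrow> complex mat" where
  "principal_sqrt A = (THE X. X \<in> carrier_mat (dim_row A) (dim_row A) \<and> X * X = A \<and>
     (\<forall>z. eigenvalue X z \<longrightarrow> Re z > 0))"

text \<open>
  A stem function \<open>f\<close> is partial: \<open>f z = None\<close> means that \<open>z\<close> is outside its domain, and
  \<open>f z = Some d\<close> means that \<open>d j\<close> is the (arbitrarily assigned) value of the \<open>j\<close>-th derivative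
  of \<open>f\<close> at \<open>z\<close>, with \<open>d 0\<close> the function value.
\<close>

type_synonym stem = "complex \<Rightarrow> (nat \<Rightarrow> complex) option"

definition stem_block :: "stem \<Rightarrow> nat \<Rightarrow> complex \<Rightarrow> complex mat" where
  "stem_block f k z =
     mat k k (\<lambda>(i, j). if i \<le> j then the (f z) (j - i) / fact (j - i) else 0)"

definition stem_jordan_matrix :: "stem \<Rightarrow> (nat \<times> complex) list \<Rightarrow> complex mat" where
  "stem_jordan_matrix f n_as = diag_block_mat (map (\<lambda>(k, z). stem_block f k z) n_as)"

text \<open>
  \<open>has_matfun_value f A B\<close> says that \<open>f(A)\<close> is defined, i.e. all eigenvalues of \<open>A\<close> are in the
  domain of \<open>f\<close>, and equals \<open>B\<close>. The choice of the Jordan decomposition is immaterial.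
\<close>

definition has_matfun_value :: "stem \<Rightarrow> complex mat \<Rightarrow> complex mat \<Rightarrow> bool" where
  "has_matfun_value f A B \<longleftrightarrow>
     (\<exists>n_as Q Q'. 0 \<notin> fst ` set n_as \<and> similar_mat_wit A (jordan_matrix n_as) Q Q' \<and>
        snd ` set n_as \<subseteq> dom f \<and> B = Q * stem_jordan_matrix f n_as * Q')"

definition primary_matrix_function ::
  "complex set \<Rightarrow> nat \<Rightarrow> stem \<Rightarrow> (complex mat \<Rightarrow> complex mat option) \<Rightarrow> bool" where
  "primary_matrix_function K m f \<sigma> \<longleftrightarrow>
     (\<forall>A \<in> mats_over K m m. \<forall>B. \<sigma> A = Some B \<longleftrightarrow> has_matfun_value f A B)"

text \<open>
  \<open>\<sigma> A = None\<close> means that \<open>\<sigma>(A)\<close> is undefined. As \<open>0\<close> is excluded from the domain of the stem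
  function, \<open>\<sigma>\<close> is defined exactly on the nonsingular matrices.
\<close>

definition generalized_matrix_sign_function ::
  "complex set \<Rightarrow> nat \<Rightarrow> (complex mat \<Rightarrow> complex mat option) \<Rightarrow> bool" where
  "generalized_matrix_sign_function K m \<sigma> \<longleftrightarrow>
     (\<exists>f. f 0 = None \<and> primary_matrix_function K m f \<sigma>) \<and>
     (\<forall>A \<in> mats_over K m m. invertible_mat A \<longrightarrow>
        (\<exists>B \<in> mats_over K m m. \<sigma> A = Some B \<and>
           (\<forall>x::real. x < 0 \<longrightarrow> \<not> eigenvalue (B * A) (complex_of_real x)) \<and>
           \<sigma> (conj_mat A) = Some (conj_mat B) \<and>
           (\<forall>z. eigenvalue B z \<longrightarrow> cmod z = 1)))"

definition generalized_polar_decomposition ::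
  "complex set \<Rightarrow> form_kind \<Rightarrow> nat \<Rightarrow> nat \<Rightarrow> complex mat \<Rightarrow> complex mat \<Rightarrow>
   (complex mat \<Rightarrow> complex mat option) \<Rightarrow> complex mat \<Rightarrow>
   complex mat \<Rightarrow> complex mat \<Rightarrow> complex mat \<Rightarrow> bool" where
  "generalized_polar_decomposition K s m n M N \<sigma> F \<Sigma> S W \<longleftrightarrow>
     \<sigma> (F * adjoint s M N F) = Some \<Sigma> \<and>
     F = S * W \<and>
     S \<in> mats_over K m m \<and> r_positive_definite S \<and>
     selfadjoint s M S \<and> selfadjoint s (M * \<Sigma>) S \<and>
     W \<in> mats_over K m n \<and> orthonormal_rows s (M * \<Sigma>) N W \<and>
     adjoint s N M (adjoint s M N W) = W"

end

theory Submission
  imports Defs "Jordan_Normal_Form.Schur_Decomposition"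
begin

text \<open>
  Write \<open>A = F F\<^bsup>[M,N]\<^esup>\<close>. In a decomposition \<open>F = S W\<close> the two selfadjointness conditions say that
  \<open>S\<close> is \<open>M\<close>-selfadjoint and commutes with \<open>\<Sigma>\<close>, and the orthonormality of the rows of \<open>W\<close> then turns
  \<open>A\<close> into \<open>\<Sigma>\<^sup>-\<^sup>1 S\<^sup>2\<close>; so \<open>S\<close> is a square root of \<open>\<Sigma> A\<close> with spectrum in the open right half-plane,
  and such a root is unique. Conversely, if \<open>A\<close> is nonsingular and \<open>F\<close> equals its double adjoint,
  then \<open>A\<close> is \<open>M\<close>-selfadjoint. The value \<open>\<sigma>(A)\<close> is unique, while conjugating \<open>A\<close> by itself, or applying
  \<open>X \<mapsto> M\<^sup>-\<^sup>1 X\<^sup># M\<close>, fixes \<open>A\<close> and carries values of \<open>\<sigma>\<close> to values of \<open>\<sigma>\<close>. Hence \<open>\<Sigma>\<close> commutes with \<open>A\<close> and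
  is \<open>M\<close>-selfadjoint. In the same way the uniqueness of the square root \<open>S\<close> of \<open>\<Sigma> A\<close> shows that \<open>S\<close>
  commutes with \<open>\<Sigma>\<close>, is \<open>M\<close>-selfadjoint, and is real when the data are.
\<close>

subsection \<open>Matrix products\<close>

text \<open>Stated with dimension equations instead of carriers: the inner dimensions are then
  determined by the factors, so the simplifier can reassociate rectangular products without
  instantiations.\<close>

lemma mult_mat_assoc_dim:
  fixes A B C :: "'a :: semiring_0 mat"
  assumes "dim_col A = dim_row B" "dim_col B = dim_row C"
  shows "A * B * C = A * (B * C)"
proof (rule assoc_mult_mat)
  show "A \<in> carrier_mat (dim_row A) (dim_row B)" by (rule carrier_matI[OF refl assms(1)])
  show "B \<in> carrier_mat (dim_row B) (dim_row C)" by (rule carrier_matI[OF refl assms(2)])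
  show "C \<in> carrier_mat (dim_row C) (dim_col C)" by (rule carrier_matI[OF refl refl])
qed

text \<open>Complements the reassociation rule: once a product is bracketed to the right, adjacent
  inverse factors appear in exactly this pattern.\<close>

lemma mult_mat_cancel_left:
  "A * B = 1\<^sub>m n \<Longrightarrow> A \<in> carrier_mat n k \<Longrightarrow> B \<in> carrier_mat k n \<Longrightarrow> dim_row C = n \<Longrightarrow> A * (B * C) = C"
  for A B C :: "'a :: semiring_1 mat"
  using assoc_mult_mat[of A n k B n C "dim_col C"] left_mult_one_mat[of C n "dim_col C"] by auto

subsection \<open>Eigenvalues\<close>

lemma eigenvalueI:
  "A \<in> carrier_mat n n \<Longrightarrow> v \<in> carrier_vec n \<Longrightarrow> v \<noteq> 0\<^sub>v n \<Longrightarrow> A *\<^sub>v v = k \<cdot>\<^sub>v v \<Longrightarrow> eigenvalue A k"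
  unfolding eigenvalue_def eigenvector_def by auto

lemma eigenvalueE:
  assumes "eigenvalue A k" "A \<in> carrier_mat n n"
  obtains v where "v \<in> carrier_vec n" "v \<noteq> 0\<^sub>v n" "A *\<^sub>v v = k \<cdot>\<^sub>v v"
  using assms unfolding eigenvalue_def eigenvector_def by auto

lemma eigenvalue_similar_iff:
  fixes A B :: "'a :: field mat"
  assumes "similar_mat_wit A B P Q"
  shows "eigenvalue A k \<longleftrightarrow> eigenvalue B k"
proof -
  have "similar_mat A B" using assms unfolding similar_mat_def by blast
  note char_poly_similar[OF this]
  thus ?thesis
    unfolding eigenvalue_root_char_poly[OF similar_mat_witD(4)[OF refl assms]]
      eigenvalue_root_char_poly[OF similar_mat_witD(5)[OF refl assms]] by simp
qed

lemma eigenvalue_upper_triangular_iff: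
  fixes U :: "'a :: field mat"
  assumes U: "U \<in> carrier_mat n n" "upper_triangular U"
  shows "eigenvalue U k \<longleftrightarrow> (\<exists>i<n. k = U $$ (i, i))"
  unfolding eigenvalue_root_char_poly[OF U(1)] char_poly_upper_triangular[OF U]
  using U(1) by (auto simp: poly_prod_list prod_list_zero_iff diag_mat_def)

lemma eigenvalue_transpose_iff:
  fixes A :: "'a :: field mat"
  assumes "A \<in> carrier_mat n n"
  shows "eigenvalue (transpose_mat A) k \<longleftrightarrow> eigenvalue A k"
  using assms by (simp add: eigenvalue_root_char_poly[of _ n])

lemma eigenvalue_uminus:
  fixes A :: "'a :: field mat"
  assumes A: "A \<in> carrier_mat n n" and "eigenvalue (- A) k"
  shows "eigenvalue A (- k)"
proof -
  obtain v where v: "v \<in> carrier_vec n" "v \<noteq> 0\<^sub>v n" "(- A) *\<^sub>v v = k \<cdot>\<^sub>v v"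
    using assms by (auto elim: eigenvalueE[of "- A" k n])
  have "A *\<^sub>v v = - k \<cdot>\<^sub>v v"
  proof (rule eq_vecI)
    fix i assume i: "i < dim_vec (- k \<cdot>\<^sub>v v)"
    hence "((- A) *\<^sub>v v) $ i = k * v $ i" using v by simp
    thus "(A *\<^sub>v v) $ i = (- k \<cdot>\<^sub>v v) $ i" using i v A by (simp add: minus_equation_iff eq_commute)
  qed (use A v in auto)
  thus ?thesis by (rule eigenvalueI[OF A v(1,2)])
qed

text \<open>The reason is the factorisation \<open>A^2 - c^2 = (A - c) (A + c)\<close>. For an
  eigenvector \<open>v\<close> of the square, \<open>(A + c) v\<close> either vanishes, which gives
  the eigenvalue \<open>- c\<close>, or is itself an eigenvector for \<open>c\<close>.\<close>

lemma eigenvalue_square: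
  fixes A :: "'a :: field mat"
  assumes A: "A \<in> carrier_mat n n" and "eigenvalue (A * A) (c\<^sup>2)"
  shows "eigenvalue A c \<or> eigenvalue A (- c)"
proof -
  obtain v where v: "v \<in> carrier_vec n" "v \<noteq> 0\<^sub>v n" "(A * A) *\<^sub>v v = c\<^sup>2 \<cdot>\<^sub>v v"
    using assms by (auto elim: eigenvalueE[of _ _ n])
  let ?w = "A *\<^sub>v v + c \<cdot>\<^sub>v v"
  have w: "?w \<in> carrier_vec n" using A v by auto
  show ?thesis
  proof (cases "?w = 0\<^sub>v n")
    case True
    have "A *\<^sub>v v = - c \<cdot>\<^sub>v v"
    proof (rule eq_vecI)
      fix i assume i: "i < dim_vec (- c \<cdot>\<^sub>v v)"
      hence "?w $ i = 0" using True v by simp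
      thus "(A *\<^sub>v v) $ i = (- c \<cdot>\<^sub>v v) $ i" using i v A by (simp add: eq_neg_iff_add_eq_0)
    qed (use A v in auto)
    thus ?thesis using eigenvalueI[OF A v(1,2)] by blast
  next
    case False
    have "A *\<^sub>v ?w = A *\<^sub>v (A *\<^sub>v v) + c \<cdot>\<^sub>v (A *\<^sub>v v)"
      using A v by (simp add: mult_add_distrib_mat_vec[of _ n n] mult_mat_vec[of _ n n])
    also have "A *\<^sub>v (A *\<^sub>v v) = c\<^sup>2 \<cdot>\<^sub>v v" using A v by simp
    also have "c\<^sup>2 \<cdot>\<^sub>v v + c \<cdot>\<^sub>v (A *\<^sub>v v) = c \<cdot>\<^sub>v ?w"
      using A v by (intro eq_vecI) (auto simp: power2_eq_square algebra_simps)
    finally show ?thesis using eigenvalueI[OF A w False] by blast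
  qed
qed

section \<open>Invertibility and the eigenvalue zero\<close>

lemma invertible_mat_if_det_nonzero:
  fixes A :: "'a :: field mat"
  assumes A: "A \<in> carrier_mat n n" and "det A \<noteq> 0"
  shows "invertible_mat A"
  using det_non_zero_imp_unit[OF assms, of undefined] A
  unfolding Units_def invertible_mat_def inverts_mat_def by (auto simp: ring_mat_def)

lemma invertible_mat_if_no_zero_eigenvalue:
  fixes A :: "'a :: field mat"
  assumes A: "A \<in> carrier_mat n n" and "\<not> eigenvalue A 0"
  shows "invertible_mat A"
proof (rule invertible_mat_if_det_nonzero[OF A], rule notI)
  assume "det A = 0"
  then obtain v where v: "v \<in> carrier_vec n" "v \<noteq> 0\<^sub>v n" "A *\<^sub>v v = 0\<^sub>v n"
    using det_0_iff_vec_prod_zero_field[OF A] by blast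
  moreover have "0 \<cdot>\<^sub>v v = 0\<^sub>v n" using v by (intro eq_vecI) auto
  ultimately show False using eigenvalueI[OF A, of v 0] assms by simp
qed

lemma invertible_mat_obtain_inverse:
  assumes "invertible_mat A" "A \<in> carrier_mat n n"
  obtains B where "B \<in> carrier_mat n n" "A * B = 1\<^sub>m n" "B * A = 1\<^sub>m n"
proof -
  from assms obtain B where B: "A * B = 1\<^sub>m n" "B * A = 1\<^sub>m (dim_row B)"
    unfolding invertible_mat_def inverts_mat_def by auto
  \<comment> \<open>\<open>invertible_mat\<close> does not record the size of \<open>B\<close>;
    comparing column counts in the two identities forces both dimensions to be
    \<open>n\<close>.\<close>
  have "dim_col (A * B) = n" "dim_col (B * A) = dim_row B" by (simp_all only: B index_one_mat)
  hence "B \<in> carrier_mat n n" using assms by auto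
  thus thesis using that[of B] B by auto
qed

lemma invertible_matI:
  assumes "A \<in> carrier_mat n n" "B \<in> carrier_mat n n" "A * B = 1\<^sub>m n" "B * A = 1\<^sub>m n"
  shows "invertible_mat A"
  using assms unfolding invertible_mat_def inverts_mat_def by auto

lemma no_zero_eigenvalue_if_invertible_mat:
  fixes A :: "'a :: field mat"
  assumes A: "A \<in> carrier_mat n n" "invertible_mat A"
  shows "\<not> eigenvalue A 0"
proof
  assume "eigenvalue A 0"
  then obtain v where v: "v \<in> carrier_vec n" "v \<noteq> 0\<^sub>v n" "A *\<^sub>v v = 0 \<cdot>\<^sub>v v"
    using A by (auto elim: eigenvalueE)
  obtain B where B: "B \<in> carrier_mat n n" "B * A = 1\<^sub>m n"
    using A invertible_mat_obtain_inverse by blast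
  have "0 \<cdot>\<^sub>v v = 0\<^sub>v n" using v by (intro eq_vecI) auto
  hence "B *\<^sub>v (0\<^sub>v n) = (B * A) *\<^sub>v v" using A(1) B(1) v by simp
  also have "\<dots> = v" using B(2) v by simp
  finally have "v = B *\<^sub>v (0\<^sub>v n)" by simp
  also have "\<dots> = 0\<^sub>v n" using B by auto
  finally show False using v by simp
qed

subsection \<open>The principal square root\<close>

text \<open>Forward substitution over the columns of \<open>D\<close>: if all earlier columns
  vanish, triangularity of \<open>U\<close> leaves only the diagonal term, so column
  \<open>j\<close> satisfies the eigenvector equation of \<open>X\<close> for
  \<open>U $$ (j, j)\<close> and must be zero.\<close>

lemma sylvester_upper_triangular_zero:
  fixes X U D :: "'a :: field mat"
  assumes X: "X \<in> carrier_mat m m" and U: "U \<in> carrier_mat n n" "upper_triangular U"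
    and D: "D \<in> carrier_mat m n" and eq: "X * D = D * U"
    and disj: "\<And>j. j < n \<Longrightarrow> \<not> eigenvalue X (U $$ (j, j))"
  shows "D = 0\<^sub>m m n"
proof -
  have "col D j = 0\<^sub>v m" if "j < n" for j
    using that
  proof (induction j rule: less_induct)
    case (less j)
    have "(col (D * U) j) $ i = U $$ (j, j) * D $$ (i, j)" if "i < m" for i
    proof -
      have *: "D $$ (i, k) * U $$ (k, j) = 0" if "k < n" "k \<noteq> j" for k
      proof (cases "k < j")
        case True
        hence "col D k $ i = 0" using less.IH[of k] that \<open>i < m\<close> by simp
        thus ?thesis using that D \<open>i < m\<close> by simp
      next
        case False
        thus ?thesis using that U by (simp add: upper_triangular_def)
      qed
      have "(col (D * U) j) $ i = (\<Sum>k<n. D $$ (i, k) * U $$ (k, j))"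
        using \<open>i < m\<close> less.prems D U by (simp add: scalar_prod_def lessThan_atLeast0)
      also have "\<dots> = D $$ (i, j) * U $$ (j, j)"
      proof -
        have "(\<Sum>k\<in>{..<n} - {j}. D $$ (i, k) * U $$ (k, j)) = 0"
          using * by (intro sum.neutral) blast
        thus ?thesis using less.prems by (subst sum.remove[of _ j]) auto
      qed
      finally show ?thesis by (simp add: mult.commute)
    qed
    hence "col (D * U) j = U $$ (j, j) \<cdot>\<^sub>v col D j"
      using D U less.prems by (intro eq_vecI) auto
    moreover have "col (X * D) j = X *\<^sub>v col D j"
      using X D less.prems by (intro eq_vecI) auto
    ultimately have "X *\<^sub>v col D j = U $$ (j, j) \<cdot>\<^sub>v col D j" using eq by simp
    thus ?case
      using disj[OF less.prems] eigenvalueI[OF X, of "col D j"] D by (metis carrier_matD(1) col_dim)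
  qed
  hence "D $$ (i, j) = 0" if "i < m" "j < n" for i j
    using that D index_col[of i D j] by simp
  thus ?thesis using D by (intro eq_matI) auto
qed

text \<open>The difference \<open>X - Y\<close> intertwines \<open>X\<close> and \<open>- Y\<close>, whose spectra lie in opposite half-planes.\<close>

lemma right_half_plane_sqrt_unique:
  fixes X Y :: "complex mat"
  assumes X: "X \<in> carrier_mat n n" and Y: "Y \<in> carrier_mat n n" and eq: "X * X = Y * Y"
    and rX: "r_positive_definite X" and rY: "r_positive_definite Y"
  shows "X = Y"
proof -
  have nY: "- Y \<in> carrier_mat n n" using Y by simp
  \<comment> \<open>Triangularising \<open>- Y\<close> as \<open>P * U * Q\<close> turns the
    intertwining relation for \<open>X - Y\<close> into \<open>X * (?D * P) = ?D * P * U\<close>,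
    where the right coefficient is triangular.\<close>
  obtain U where U: "U \<in> carrier_mat n n" "upper_triangular U" and "similar_mat (- Y) U"
    using char_poly_factorized[OF nY] schur_decomposition_exists[OF nY] by blast
  then obtain P Q where sim: "similar_mat_wit (- Y) U P Q" unfolding similar_mat_def by blast
  note w = similar_mat_witD2[OF nY sim]
  let ?D = "X - Y"
  have D: "?D \<in> carrier_mat n n" using Y by (rule minus_carrier_mat)
  have "X * ?D = ?D * (- Y)"
  proof -
    have "X * ?D = X * X - X * Y" using X Y by (simp add: mult_minus_distrib_mat[of _ n n])
    moreover have "?D * Y = X * Y - Y * Y" using X Y by (simp add: minus_mult_distrib_mat[of _ n n])
    ultimately show ?thesis unfolding eq using X Y by (intro eq_matI) auto
  qed
  hence "X * ?D * P = ?D * (P * U * Q) * P" unfolding w(3) by simp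
  moreover have "X * ?D * P = X * (?D * P)" by (rule assoc_mult_mat[OF X D w(6)])
  moreover have "?D * (P * U * Q) * P = ?D * P * U"
    using D w(2) w(4-) by (simp add: mult_mat_assoc_dim)
  ultimately have "X * (?D * P) = ?D * P * U" by simp
  hence "?D * P = 0\<^sub>m n n"
  proof (intro sylvester_upper_triangular_zero[OF X U])
    fix j assume "j < n"
    hence "eigenvalue (- Y) (U $$ (j, j))"
      unfolding eigenvalue_similar_iff[OF sim] eigenvalue_upper_triangular_iff[OF U] by blast
    hence "Re (U $$ (j, j)) < 0"
      using eigenvalue_uminus[OF Y] rY unfolding r_positive_definite_def by fastforce
    thus "\<not> eigenvalue X (U $$ (j, j))" using rX unfolding r_positive_definite_def by fastforce
  qed (use D w(6) in auto)
  hence "?D * P * Q = 0\<^sub>m n n" using w(7) by simp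
  moreover have "?D * P * Q = ?D" using D w(1) w(4-) by (simp add: mult_mat_assoc_dim)
  ultimately have "?D = 0\<^sub>m n n" by simp
  hence "?D $$ (i, j) = 0" if "i < n" "j < n" for i j using that by simp
  thus ?thesis using X Y by (intro eq_matI) auto
qed

section \<open>Existence of square roots with spectrum in the right half-plane\<close>

lemma Re_csqrt_pos:
  assumes "\<And>x :: real. x \<le> 0 \<Longrightarrow> z \<noteq> complex_of_real x"
  shows "Re (csqrt z) > 0"
proof (rule ccontr)
  \<comment> \<open>The branch \<open>csqrt\<close> never leaves the closed right half-plane, so
    only the imaginary axis remains, and there the square is a nonpositive real number.\<close>
  assume "\<not> Re (csqrt z) > 0"
  hence "Re (csqrt z) = 0" using csqrt_principal[of z] by auto
  hence "csqrt z = \<i> * complex_of_real (Im (csqrt z))" by (simp add: complex_eq_iff)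
  hence "(csqrt z)\<^sup>2 = complex_of_real (- (Im (csqrt z))\<^sup>2)"
    by (metis mult.commute mult_minus1_right of_real_minus of_real_power power2_i power_mult_distrib)
  hence "z = complex_of_real (- (Im (csqrt z))\<^sup>2)" by simp
  thus False using assms[of "- (Im (csqrt z))\<^sup>2"] by simp
qed

text \<open>Induction on the size, splitting off the last row and column. The root of the leading
  block is bordered by a column \<open>?r\<close> and the scalar \<open>c\<close>, the principal
  root of the last diagonal entry.\<close>

lemma upper_triangular_sqrt_exists:
  fixes U :: "complex mat"
  assumes "U \<in> carrier_mat n n" "upper_triangular U"
    and "\<And>i. i < n \<Longrightarrow> Re (csqrt (U $$ (i, i))) > 0"
  shows "\<exists>R \<in> carrier_mat n n. upper_triangular R \<and> R * R = U \<and> (\<forall>i<n. Re (R $$ (i, i)) > 0)"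
  using assms
proof (induction n arbitrary: U)
  case 0
  thus ?case by (intro bexI[of _ U]) auto
next
  case (Suc n)
  obtain U1 u z l where split: "split_block U n n = (U1, u, z, l)" by (metis prod_cases4)
  note sp = split_block[OF split, of 1 1]
  have U1: "U1 \<in> carrier_mat n n" and u: "u \<in> carrier_mat n 1" and z: "z \<in> carrier_mat 1 n"
    and l: "l \<in> carrier_mat 1 1" and U: "U = four_block_mat U1 u z l"
    using sp Suc.prems(1) by auto
  have U1_U: "U1 $$ (i, j) = U $$ (i, j)" if "i < n" "j < n" for i j
    using that U1 l unfolding U by simp
  have z0: "z = 0\<^sub>m 1 n"
  proof (rule eq_matI)
    fix i j assume ij: "i < dim_row (0\<^sub>m 1 n :: complex mat)" "j < dim_col (0\<^sub>m 1 n :: complex mat)"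
    hence "z $$ (i, j) = U $$ (n, j)" using U1 z l unfolding U by simp
    also have "\<dots> = 0" using Suc.prems ij by (auto simp: upper_triangular_def)
    finally show "z $$ (i, j) = 0\<^sub>m 1 n $$ (i, j)" using ij by simp
  qed (use z in auto)
  have "upper_triangular U1"
    using Suc.prems(1,2) U1 U1_U unfolding upper_triangular_def by auto
  then obtain R where R: "R \<in> carrier_mat n n" "upper_triangular R" "R * R = U1"
    and Rpos: "\<forall>i<n. Re (R $$ (i, i)) > 0"
    using Suc.IH[OF U1] Suc.prems(3) U1_U by auto
  define c where "c = csqrt (U $$ (n, n))"
  have c: "Re c > 0" using Suc.prems(3)[of n] by (simp add: c_def)
  have "c * c = U $$ (n, n)" using power2_csqrt unfolding c_def power2_eq_square .
  hence l_c: "l = c\<^sup>2 \<cdot>\<^sub>m 1\<^sub>m 1"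
    using U1 l unfolding U by (intro eq_matI) (auto simp: power2_eq_square)
  \<comment> \<open>The upper right block of the square of the bordered matrix is
    \<open>R * r + c r\<close>, so \<open>r\<close> has to solve \<open>?T * r = u\<close>. This is
    solvable because the diagonal entries of \<open>R\<close> and \<open>c\<close> have positive
    real parts, hence no diagonal entry of \<open>?T\<close> vanishes.\<close>
  let ?T = "R + c \<cdot>\<^sub>m 1\<^sub>m n"
  have T: "?T \<in> carrier_mat n n" "upper_triangular ?T"
    using R unfolding upper_triangular_def by auto
  have "\<not> eigenvalue ?T 0"
  proof
    assume "eigenvalue ?T 0"
    then obtain i where i: "i < n" "?T $$ (i, i) = 0"
      unfolding eigenvalue_upper_triangular_iff[OF T] by auto
    hence "Re (R $$ (i, i)) + Re c = 0" using R by (simp flip: plus_complex.sel)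
    thus False using Rpos i c by (metis add_pos_pos less_irrefl)
  qed
  then obtain T' where T': "T' \<in> carrier_mat n n" "?T * T' = 1\<^sub>m n"
    using invertible_mat_if_no_zero_eigenvalue[OF T(1)] invertible_mat_obtain_inverse[OF _ T(1)] by blast
  let ?r = "T' * u"
  have r: "?r \<in> carrier_mat n 1" using T' u by simp
  have "?T * ?r = u" using T' T u by (intro mult_mat_cancel_left) auto
  moreover have "?T * ?r = R * ?r + c \<cdot>\<^sub>m ?r"
    using R(1) r by (subst add_mult_distrib_mat[of _ n n]) (auto simp: mult_smult_assoc_mat[of _ n n])
  moreover have "?r * (c \<cdot>\<^sub>m 1\<^sub>m 1) = c \<cdot>\<^sub>m ?r" 
    by (simp only: mult_smult_distrib[OF r one_carrier_mat] right_mult_one_mat[OF r])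
  ultimately have Tr: "R * ?r + ?r * (c \<cdot>\<^sub>m 1\<^sub>m 1) = u" by simp
  let ?S = "four_block_mat R ?r (0\<^sub>m 1 n) (c \<cdot>\<^sub>m 1\<^sub>m 1)"
  have S: "?S \<in> carrier_mat (Suc n) (Suc n)" using R by (auto intro!: carrier_matI)
  have "?S * ?S = four_block_mat (R * R + ?r * 0\<^sub>m 1 n) (R * ?r + ?r * (c \<cdot>\<^sub>m 1\<^sub>m 1))
      (0\<^sub>m 1 n * R + (c \<cdot>\<^sub>m 1\<^sub>m 1) * 0\<^sub>m 1 n) (0\<^sub>m 1 n * ?r + (c \<cdot>\<^sub>m 1\<^sub>m 1) * (c \<cdot>\<^sub>m 1\<^sub>m 1))"
    using R r by (intro mult_four_block_mat) auto
  also have "R * R + ?r * 0\<^sub>m 1 n = U1" 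
    unfolding R(3) by (simp only: right_mult_zero_mat[OF r] right_add_zero_mat[OF U1])
  also have "0\<^sub>m 1 n * R + (c \<cdot>\<^sub>m 1\<^sub>m 1) * 0\<^sub>m 1 n = z"
    unfolding z0 using R by (simp add: right_mult_zero_mat[of _ 1])
  also have "0\<^sub>m 1 n * ?r + (c \<cdot>\<^sub>m 1\<^sub>m 1) * (c \<cdot>\<^sub>m 1\<^sub>m 1) = l"
    unfolding l_c left_mult_zero_mat[OF r]
    by (intro eq_matI) (auto simp: power2_eq_square scalar_prod_def)
  finally have "?S * ?S = U" unfolding Tr U .
  moreover have "upper_triangular ?S"
    using R by (intro upper_triangular_four_block) auto
  moreover have "Re (?S $$ (i, i)) > 0" if "i < Suc n" for i
    using that R Rpos c by (cases "i < n") auto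
  ultimately show ?case using S by blast
qed

text \<open>A Schur form reduces to the triangular case: its diagonal consists of the eigenvalues of
  \<open>B\<close>, whose principal roots have positive real part, and similarity carries the root
  back.\<close>

lemma right_half_plane_sqrt_exists:
  fixes B :: "complex mat"
  assumes B: "B \<in> carrier_mat n n" and ev: "\<And>x :: real. x \<le> 0 \<Longrightarrow> \<not> eigenvalue B (complex_of_real x)"
  shows "\<exists>X \<in> carrier_mat n n. X * X = B \<and> r_positive_definite X"
proof -
  obtain U where U: "U \<in> carrier_mat n n" "upper_triangular U" and "similar_mat B U"
    using char_poly_factorized[OF B] schur_decomposition_exists[OF B] by blast
  then obtain P Q where sim: "similar_mat_wit B U P Q" unfolding similar_mat_def by blast
  note w = similar_mat_witD2[OF B sim]
  have "Re (csqrt (U $$ (i, i))) > 0" if "i < n" for i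
    using that ev eigenvalue_similar_iff[OF sim] eigenvalue_upper_triangular_iff[OF U]
    by (intro Re_csqrt_pos) metis
  then obtain R where R: "R \<in> carrier_mat n n" "upper_triangular R" "R * R = U"
    and pos: "\<forall>i<n. Re (R $$ (i, i)) > 0"
    using upper_triangular_sqrt_exists[OF U] by blast
  let ?X = "P * R * Q"
  have X: "?X \<in> carrier_mat n n" using w R by simp
  have "?X * ?X = P * (R * R) * Q"
    using w(4-) R(1) mult_mat_cancel_left[OF w(2)] by (simp add: mult_mat_assoc_dim)
  hence "?X * ?X = B" using R w(3) by simp
  moreover have "similar_mat_wit ?X R P Q"
    using w R X by (intro similar_mat_witI) auto
  hence "r_positive_definite ?X"
    using X pos eigenvalue_upper_triangular_iff[OF R(1,2)] eigenvalue_similar_iff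
    unfolding r_positive_definite_def by (metis carrier_matD square_mat.elims(3))
  ultimately show ?thesis using X by blast
qed

subsection \<open>Primary matrix functions\<close>

lemma similar_mat_wit_transpose:
  fixes A B :: "'a :: comm_semiring_1 mat"
  assumes "similar_mat_wit A B P Q"
  shows "similar_mat_wit (transpose_mat A) (transpose_mat B) (transpose_mat Q) (transpose_mat P)"
proof -
  define n where "n = dim_row A"
  note w = similar_mat_witD[OF n_def assms]
  have "transpose_mat A = transpose_mat Q * (transpose_mat B * transpose_mat P)"
    unfolding w(3) using w(5-7) by (simp add: transpose_mult[of _ n n _ n])
  also have "\<dots> = transpose_mat Q * transpose_mat B * transpose_mat P"
    using w(5-7) by (simp add: assoc_mult_mat[of _ n n _ n _ n])
  finally show ?thesis
    using w(4-7) arg_cong[OF w(1), of transpose_mat] arg_cong[OF w(2), of transpose_mat]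
    by (intro similar_mat_witI[of _ _ n]) (simp_all add: transpose_mult[of _ n n _ n])
qed

lemma similar_mat_wit_conjugate:
  assumes A: "A \<in> carrier_mat n n" "P \<in> carrier_mat n n" "Q \<in> carrier_mat n n"
    and "P * Q = 1\<^sub>m n" "Q * P = 1\<^sub>m n"
  shows "similar_mat_wit (P * A * Q) A P Q"
  using assms by (intro similar_mat_witI[of _ _ n]) auto

section \<open>Transposition of block Toeplitz matrices by index reversal\<close>

definition toeplitz_mat :: "nat \<Rightarrow> (nat \<Rightarrow> 'a :: zero) \<Rightarrow> 'a mat" where
  "toeplitz_mat k c = mat k k (\<lambda>(i, j). if i \<le> j then c (j - i) else 0)"

text \<open>The permutation matrix with ones on the antidiagonal. Multiplying by it on the left
  reverses the rows, on the right the columns.\<close>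

definition reversal_mat :: "nat \<Rightarrow> 'a :: {zero, one} mat" where
  "reversal_mat k = mat k k (\<lambda>(i, j). if j = k - Suc i then 1 else 0)"

lemma toeplitz_mat_carrier [simp]: "toeplitz_mat k c \<in> carrier_mat k k"
  by (simp add: toeplitz_mat_def)

lemma reversal_mat_carrier [simp]: "reversal_mat k \<in> carrier_mat k k"
  by (simp add: reversal_mat_def)

lemma reversal_mat_mult_left:
  fixes A :: "'a :: semiring_1 mat"
  assumes "A \<in> carrier_mat k n"
  shows "reversal_mat k * A = mat k n (\<lambda>(i, j). A $$ (k - Suc i, j))"
proof (rule eq_matI)
  fix i j assume "i < dim_row (mat k n (\<lambda>(i, j). A $$ (k - Suc i, j)))"
    "j < dim_col (mat k n (\<lambda>(i, j). A $$ (k - Suc i, j)))"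
  hence ij: "i < k" "j < n" by auto
  have "(reversal_mat k * A) $$ (i, j) = (\<Sum>l = 0..<k. (if l = k - Suc i then 1 else 0) * A $$ (l, j))"
    using ij assms by (simp add: reversal_mat_def scalar_prod_def)
  also have "\<dots> = (\<Sum>l = 0..<k. if l = k - Suc i then A $$ (l, j) else 0)"
    by (intro sum.cong) auto
  finally show "(reversal_mat k * A) $$ (i, j) = mat k n (\<lambda>(i, j). A $$ (k - Suc i, j)) $$ (i, j)"
    using ij by simp
qed (use assms in \<open>auto simp: reversal_mat_def\<close>)

lemma reversal_mat_mult_right:
  fixes A :: "'a :: semiring_1 mat"
  assumes "A \<in> carrier_mat n k"
  shows "A * reversal_mat k = mat n k (\<lambda>(i, j). A $$ (i, k - Suc j))"
proof (rule eq_matI)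
  fix i j assume "i < dim_row (mat n k (\<lambda>(i, j). A $$ (i, k - Suc j)))"
    "j < dim_col (mat n k (\<lambda>(i, j). A $$ (i, k - Suc j)))"
  hence ij: "i < n" "j < k" by auto
  have "(A * reversal_mat k) $$ (i, j) = (\<Sum>l = 0..<k. A $$ (i, l) * (if j = k - Suc l then 1 else 0))"
    using ij assms by (simp add: reversal_mat_def scalar_prod_def)
  \<comment> \<open>For \<open>j\<close> and \<open>l\<close> below \<open>k\<close> the two
    conditions agree despite truncated subtraction; the new one isolates a single summation
    index.\<close>
  also have "\<dots> = (\<Sum>l = 0..<k. if l = k - Suc j then A $$ (i, l) else 0)"
    using ij by (intro sum.cong) auto
  finally show "(A * reversal_mat k) $$ (i, j) = mat n k (\<lambda>(i, j). A $$ (i, k - Suc j)) $$ (i, j)"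
    using ij by simp
qed (use assms in \<open>auto simp: reversal_mat_def\<close>)

lemma reversal_mat_involution: "reversal_mat k * reversal_mat k = (1\<^sub>m k :: 'a :: semiring_1 mat)"
  unfolding reversal_mat_mult_left[OF reversal_mat_carrier]
  by (rule eq_matI) (auto simp: reversal_mat_def)

text \<open>Replacing both indices by their reversals negates the index difference and therefore
  exchanges upper and lower triangle while keeping the coefficient on each diagonal.\<close>

lemma transpose_toeplitz_mat_similar:
  "similar_mat_wit (transpose_mat (toeplitz_mat k c)) (toeplitz_mat k c) (reversal_mat k) (reversal_mat k)"
  for c :: "nat \<Rightarrow> 'a :: comm_semiring_1"
proof (rule similar_mat_witI)
  have *: "reversal_mat k * toeplitz_mat k c \<in> carrier_mat k k"
    by (rule mult_carrier_mat[OF reversal_mat_carrier toeplitz_mat_carrier])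
  show "transpose_mat (toeplitz_mat k c) = reversal_mat k * toeplitz_mat k c * reversal_mat k"
    unfolding reversal_mat_mult_right[OF *] unfolding reversal_mat_mult_left[OF toeplitz_mat_carrier]
    by (rule eq_matI) (auto simp: toeplitz_mat_def)
qed (auto simp: reversal_mat_involution)

text \<open>Together with the next lemma this puts a Jordan block and its stem image into the same
  Toeplitz form, so that one conjugation treats both.\<close>

lemma jordan_block_toeplitz:
  "jordan_block k z = toeplitz_mat k (\<lambda>d. if d = 0 then z else if d = 1 then 1 else 0)"
  unfolding jordan_block_def toeplitz_mat_def by (rule eq_matI) auto

lemma stem_block_toeplitz: "stem_block f k z = toeplitz_mat k (\<lambda>d. the (f z) d / fact d)"
  unfolding stem_block_def toeplitz_mat_def ..

text \<open>Makes the block sizes explicit. They depend on the list alone and not on the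
  coefficients \<open>g\<close>, as the induction below requires.\<close>

lemma diag_block_toeplitz_Cons:
  "diag_block_mat (map (\<lambda>(k, z). toeplitz_mat k (g z)) ((k, z) # n_as)) =
    four_block_mat (toeplitz_mat k (g z)) (0\<^sub>m k (sum_list (map fst n_as)))
      (0\<^sub>m (sum_list (map fst n_as)) k) (diag_block_mat (map (\<lambda>(k, z). toeplitz_mat k (g z)) n_as))"
  "diag_block_mat (map (\<lambda>(k, z). toeplitz_mat k (g z)) n_as)
    \<in> carrier_mat (sum_list (map fst n_as)) (sum_list (map fst n_as))"
proof -
  have *: "map (dim_row \<circ> (\<lambda>(k, z). toeplitz_mat k (g z))) n_as = map fst n_as"
    "map (dim_col \<circ> (\<lambda>(k, z). toeplitz_mat k (g z))) n_as = map fst n_as"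
    by (auto simp: toeplitz_mat_def)
  show "diag_block_mat (map (\<lambda>(k, z). toeplitz_mat k (g z)) n_as)
    \<in> carrier_mat (sum_list (map fst n_as)) (sum_list (map fst n_as))"
    by (intro carrier_matI) (simp_all add: dim_diag_block_mat *)
  show "diag_block_mat (map (\<lambda>(k, z). toeplitz_mat k (g z)) ((k, z) # n_as)) =
    four_block_mat (toeplitz_mat k (g z)) (0\<^sub>m k (sum_list (map fst n_as)))
      (0\<^sub>m (sum_list (map fst n_as)) k) (diag_block_mat (map (\<lambda>(k, z). toeplitz_mat k (g z)) n_as))"
    by (simp add: Let_def dim_diag_block_mat *) (simp add: toeplitz_mat_def)
qed

text \<open>The conjugating matrix does not depend on the Toeplitz coefficients, so that it serves for
  a Jordan matrix and for its image under a stem function at the same time.\<close>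

lemma transpose_diag_block_toeplitz_similar:
  fixes n_as :: "(nat \<times> 'b) list"
  shows "\<exists>R. \<forall>g :: 'b \<Rightarrow> nat \<Rightarrow> 'a :: field.
    similar_mat_wit (transpose_mat (diag_block_mat (map (\<lambda>(k, z). toeplitz_mat k (g z)) n_as)))
      (diag_block_mat (map (\<lambda>(k, z). toeplitz_mat k (g z)) n_as)) R R"
proof (induction n_as)
  case Nil
  show ?case
    by (rule exI[of _ "1\<^sub>m 0"]) (auto intro!: similar_mat_witI[of _ _ 0])
next
  case (Cons a n_as)
  obtain k z where a: "a = (k, z)" by (cases a)
  let ?n = "sum_list (map fst n_as)"
  let ?D = "\<lambda>g :: 'b \<Rightarrow> nat \<Rightarrow> 'a. diag_block_mat (map (\<lambda>(k, z). toeplitz_mat k (g z)) n_as)"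
  obtain R where R: "\<And>g. similar_mat_wit (transpose_mat (?D g)) (?D g) R R"
    using Cons.IH by blast
  note car = diag_block_toeplitz_Cons(2)[of _ n_as]
  \<comment> \<open>The induction hypothesis does not state the size of \<open>R\<close>; it is
    recovered from the similarity witness for an arbitrary \<open>g\<close>.\<close>
  have Rc: "R \<in> carrier_mat ?n ?n"
    using similar_mat_witD2(6)[OF _ R] car by (metis transpose_carrier_mat)
  let ?R = "four_block_mat (reversal_mat k) (0\<^sub>m k ?n) (0\<^sub>m ?n k) R"
  have "similar_mat_wit
      (four_block_mat (transpose_mat (toeplitz_mat k (g z))) (0\<^sub>m k ?n) (0\<^sub>m ?n k) (transpose_mat (?D g)))
      (four_block_mat (toeplitz_mat k (g z)) (0\<^sub>m k ?n) (0\<^sub>m ?n k) (?D g)) ?R ?R" for g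
  proof (rule similar_mat_wit_four_block[OF transpose_toeplitz_mat_similar R])
    show "0\<^sub>m k ?n = reversal_mat k * 0\<^sub>m k ?n * R"
      by (simp only: right_mult_zero_mat[OF reversal_mat_carrier] left_mult_zero_mat[OF Rc])
    show "0\<^sub>m ?n k = R * 0\<^sub>m ?n k * reversal_mat k"
      by (simp only: right_mult_zero_mat[OF Rc] left_mult_zero_mat[OF reversal_mat_carrier])
  qed (use car in auto)
  moreover have "four_block_mat (transpose_mat (toeplitz_mat k (g z))) (0\<^sub>m k ?n) (0\<^sub>m ?n k) (transpose_mat (?D g))
    = transpose_mat (four_block_mat (toeplitz_mat k (g z)) (0\<^sub>m k ?n) (0\<^sub>m ?n k) (?D g))" for g
    by (simp add: transpose_four_block_mat[OF toeplitz_mat_carrier zero_carrier_mat zero_carrier_mat car])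
  ultimately show ?case
    unfolding a diag_block_toeplitz_Cons(1) by metis
qed

lemma transpose_jordan_matrix_similar:
  obtains R where
    "similar_mat_wit (transpose_mat (jordan_matrix n_as)) (jordan_matrix n_as) R R"
    "similar_mat_wit (transpose_mat (stem_jordan_matrix f n_as)) (stem_jordan_matrix f n_as) R R"
proof -
  obtain R where "similar_mat_wit (transpose_mat (diag_block_mat (map (\<lambda>(k, z). toeplitz_mat k (g z)) n_as)))
      (diag_block_mat (map (\<lambda>(k, z). toeplitz_mat k (g z)) n_as)) R R"
    for g :: "complex \<Rightarrow> nat \<Rightarrow> complex"
    using transpose_diag_block_toeplitz_similar by blast
  \<comment> \<open>The same \<open>R\<close> is used with two coefficient families: those of the
    Jordan blocks and those prescribed by the stem function.\<close>
  from that[OF this[of "\<lambda>z d. if d = 0 then z else if d = 1 then 1 else 0",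
        folded jordan_block_toeplitz jordan_matrix_def]
      this[of "\<lambda>z d. the (f z) d / fact d", folded stem_block_toeplitz stem_jordan_matrix_def]]
  show thesis .
qed

section \<open>Stem function values under similarity and transposition\<close>

lemma stem_jordan_matrix_carrier:
  "stem_jordan_matrix f n_as \<in> carrier_mat (sum_list (map fst n_as)) (sum_list (map fst n_as))"
  unfolding stem_jordan_matrix_def stem_block_toeplitz by (rule diag_block_toeplitz_Cons(2))

text \<open>Presents argument and value symmetrically, as two similarities with the same
  transformation. Closure properties then follow by composing similarities on both sides.\<close>

lemma has_matfun_value_iff:
  "has_matfun_value f A B \<longleftrightarrow>
     (\<exists>n_as Q Q'. 0 \<notin> fst ` set n_as \<and> snd ` set n_as \<subseteq> dom f \<and>
        similar_mat_wit A (jordan_matrix n_as) Q Q' \<and> similar_mat_wit B (stem_jordan_matrix f n_as) Q Q')"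
proof -
  have "B = Q * stem_jordan_matrix f n_as * Q' \<longleftrightarrow> similar_mat_wit B (stem_jordan_matrix f n_as) Q Q'"
    if "similar_mat_wit A (jordan_matrix n_as) Q Q'" for n_as Q Q'
  proof
    note w = similar_mat_witD[OF refl that]
    have "sum_list (map fst n_as) = dim_row A"
      using w(5) by (metis carrier_matD(1) jordan_matrix_dim(1))
    hence "stem_jordan_matrix f n_as \<in> carrier_mat (dim_row A) (dim_row A)"
      using stem_jordan_matrix_carrier by metis
    thus "similar_mat_wit B (stem_jordan_matrix f n_as) Q Q'"
      if "B = Q * stem_jordan_matrix f n_as * Q'"
      unfolding that using w(1,2,6,7) by (intro similar_mat_wit_conjugate)
  qed (rule similar_mat_witD(3)[OF refl])
  thus ?thesis unfolding has_matfun_value_def by blast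
qed

lemma has_matfun_value_conjugate:
  assumes fA: "has_matfun_value f A B" and A: "A \<in> carrier_mat n n"
    and P: "P \<in> carrier_mat n n" "Q \<in> carrier_mat n n" "P * Q = 1\<^sub>m n" "Q * P = 1\<^sub>m n"
  shows "has_matfun_value f (P * A * Q) (P * B * Q)"
proof -
  obtain n_as R R' where *: "0 \<notin> fst ` set n_as" "snd ` set n_as \<subseteq> dom f"
    and wA: "similar_mat_wit A (jordan_matrix n_as) R R'"
    and wB: "similar_mat_wit B (stem_jordan_matrix f n_as) R R'"
    using fA unfolding has_matfun_value_iff by blast
  have "R \<in> carrier_mat n n" using similar_mat_witD2(6)[OF A wA] .
  hence B: "B \<in> carrier_mat n n"
    using similar_mat_witD(4,6)[OF refl wB] by (metis carrier_matD(1))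
  show ?thesis
    unfolding has_matfun_value_iff
    using * similar_mat_wit_trans[OF similar_mat_wit_conjugate[OF A P] wA]
      similar_mat_wit_trans[OF similar_mat_wit_conjugate[OF B P] wB] by blast
qed

text \<open>Transposing a Jordan decomposition leaves transposed Jordan blocks; the common matrix
  \<open>R\<close> brings them and their stem images back to the original form, so the Jordan data
  stay the same.\<close>

lemma has_matfun_value_transpose:
  assumes "has_matfun_value f A B"
  shows "has_matfun_value f (transpose_mat A) (transpose_mat B)"
proof -
  obtain n_as Q Q' where *: "0 \<notin> fst ` set n_as" "snd ` set n_as \<subseteq> dom f"
    and wA: "similar_mat_wit A (jordan_matrix n_as) Q Q'"
    and wB: "similar_mat_wit B (stem_jordan_matrix f n_as) Q Q'"
    using assms unfolding has_matfun_value_iff by blast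
  obtain R where "similar_mat_wit (transpose_mat (jordan_matrix n_as)) (jordan_matrix n_as) R R"
    "similar_mat_wit (transpose_mat (stem_jordan_matrix f n_as)) (stem_jordan_matrix f n_as) R R"
    by (rule transpose_jordan_matrix_similar)
  thus ?thesis
    unfolding has_matfun_value_iff
    using * similar_mat_wit_trans[OF similar_mat_wit_transpose[OF wA]]
      similar_mat_wit_trans[OF similar_mat_wit_transpose[OF wB]] by blast
qed

text \<open>Every eigenvalue of \<open>A\<close> occurs in the Jordan data, and these lie in the
  domain of \<open>f\<close>, which omits zero.\<close>

lemma has_matfun_value_invertible:
  assumes "has_matfun_value f A B" "f 0 = None" "A \<in> carrier_mat n n"
  shows "invertible_mat A"
proof (rule invertible_mat_if_no_zero_eigenvalue[OF assms(3)])
  obtain n_as Q Q' where dom: "snd ` set n_as \<subseteq> dom f"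
    and wA: "similar_mat_wit A (jordan_matrix n_as) Q Q'"
    using assms(1) unfolding has_matfun_value_iff by blast
  have "poly (char_poly (jordan_matrix n_as)) 0 \<noteq> 0"
  proof
    assume "poly (char_poly (jordan_matrix n_as)) 0 = 0"
    hence "\<exists>(n, a) \<in> set n_as. poly ([:- a, 1:] ^ n) 0 = 0"
      unfolding jordan_matrix_char_poly by (auto simp: poly_prod_list prod_list_zero_iff)
    hence "0 \<in> snd ` set n_as" by force
    thus False using dom assms(2) by auto
  qed
  thus "\<not> eigenvalue A 0"
    unfolding eigenvalue_similar_iff[OF wA] eigenvalue_root_char_poly[OF jordan_matrix_carrier] .
qed

subsection \<open>Adjoints\<close>

lemma conj_mat_carrier [simp]: "conj_mat A \<in> carrier_mat m n \<longleftrightarrow> A \<in> carrier_mat m n"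
  by (simp add: conj_mat_def)

lemma conj_mat_mult:
  assumes "A \<in> carrier_mat m k" "B \<in> carrier_mat k n"
  shows "conj_mat (A * B) = conj_mat A * conj_mat B"
  using assms by (intro eq_matI) (auto simp: conj_mat_def scalar_prod_def)

lemma conj_mat_one: "conj_mat (1\<^sub>m n) = 1\<^sub>m n"
  by (rule eq_matI) (auto simp: conj_mat_def)

lemma conj_mat_conj_mat: "conj_mat (conj_mat A) = A"
  by (rule eq_matI) (auto simp: conj_mat_def)

lemma conj_mat_transpose: "conj_mat (transpose_mat A) = transpose_mat (conj_mat A)"
  by (rule eq_matI) (auto simp: conj_mat_def)

text \<open>Entrywise conjugation of an eigenvector of \<open>conj_mat A\<close> gives an
  eigenvector of \<open>A\<close>.\<close>

lemma eigenvalue_conj_mat: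
  assumes A: "A \<in> carrier_mat n n" and "eigenvalue (conj_mat A) z"
  shows "eigenvalue A (cnj z)"
proof -
  obtain v where v: "v \<in> carrier_vec n" "v \<noteq> 0\<^sub>v n" "conj_mat A *\<^sub>v v = z \<cdot>\<^sub>v v"
    using assms by (auto elim: eigenvalueE[of _ _ n])
  have "map_vec cnj v \<noteq> 0\<^sub>v n"
  proof
    assume *: "map_vec cnj v = 0\<^sub>v n"
    have "v $ i = 0" if "i < n" for i
      using that v(1) arg_cong[OF *, of "\<lambda>w. w $ i"] by simp
    hence "v = 0\<^sub>v n" using v(1) by (intro eq_vecI) auto
    thus False using v(2) by simp
  qed
  moreover have "A *\<^sub>v map_vec cnj v = cnj z \<cdot>\<^sub>v map_vec cnj v"
  proof (rule eq_vecI)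
    fix i assume "i < dim_vec (cnj z \<cdot>\<^sub>v map_vec cnj v)"
    hence i: "i < n" using v(1) by simp
    have "(A *\<^sub>v map_vec cnj v) $ i = cnj ((conj_mat A *\<^sub>v v) $ i)"
      using i A v(1) by (simp add: conj_mat_def scalar_prod_def)
    thus "(A *\<^sub>v map_vec cnj v) $ i = (cnj z \<cdot>\<^sub>v map_vec cnj v) $ i"
      using i v by simp
  qed (use A v in auto)
  ultimately show ?thesis using v(1) by (intro eigenvalueI[OF A, of "map_vec cnj v"]) auto
qed

lemma sharp_carrier [simp]: "sharp s A \<in> carrier_mat n m \<longleftrightarrow> A \<in> carrier_mat m n"
  by (cases s) auto

lemma sharp_dim [simp]: "dim_row (sharp s A) = dim_col A" "dim_col (sharp s A) = dim_row A"
  by (cases s; simp add: conj_mat_def)+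

lemma sharp_mult:
  assumes "A \<in> carrier_mat m k" "B \<in> carrier_mat k n"
  shows "sharp s (A * B) = sharp s B * sharp s A"
  using assms by (cases s) (auto simp: conj_mat_mult[OF assms] intro!: transpose_mult[of _ m k _ n])

lemma sharp_one [simp]: "sharp s (1\<^sub>m n) = 1\<^sub>m n"
  by (cases s) (auto simp: conj_mat_one)

lemma sharp_sharp [simp]: "sharp s (sharp s A) = A"
  by (cases s) (simp_all add: conj_mat_transpose conj_mat_conj_mat)

lemma conj_mat_sharp: "conj_mat (sharp s A) = sharp s (conj_mat A)"
  by (cases s) (simp_all add: conj_mat_transpose)

section \<open>Invariance of r-positive-definiteness\<close>

lemma r_positive_definite_conj_mat:
  assumes "A \<in> carrier_mat n n" "r_positive_definite A"
  shows "r_positive_definite (conj_mat A)"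
  using assms eigenvalue_conj_mat[OF assms(1)] unfolding r_positive_definite_def
  by (auto simp: conj_mat_def dest: eigenvalue_conj_mat[OF assms(1), unfolded conj_mat_def])

lemma r_positive_definite_sharp:
  assumes "A \<in> carrier_mat n n" "r_positive_definite A"
  shows "r_positive_definite (sharp s A)"
proof -
  have "r_positive_definite (transpose_mat B)" if "B \<in> carrier_mat n n" "r_positive_definite B" for B
    using that unfolding r_positive_definite_def by (auto simp: eigenvalue_transpose_iff)
  thus ?thesis using assms r_positive_definite_conj_mat[OF assms] by (cases s) auto
qed

lemma r_positive_definite_similar:
  assumes "similar_mat_wit A B P Q" "r_positive_definite B"
  shows "r_positive_definite A"
  unfolding r_positive_definite_def eigenvalue_similar_iff[OF assms(1)]
proof
  show "square_mat A" using carrier_matD(2)[OF similar_mat_witD(4)[OF refl assms(1)]] by simp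
  show "\<forall>z. eigenvalue B z \<longrightarrow> Re z > 0" using assms(2) unfolding r_positive_definite_def by blast
qed

section \<open>Inverses and matrices over the scalar field\<close>

lemma mat_inv:
  assumes A: "A \<in> carrier_mat n n" "invertible_mat A"
  shows "mat_inv A \<in> carrier_mat n n" "A * mat_inv A = 1\<^sub>m n" "mat_inv A * A = 1\<^sub>m n"
proof -
  obtain B where "B \<in> carrier_mat n n" "A * B = 1\<^sub>m n" "B * A = 1\<^sub>m n"
    using invertible_mat_obtain_inverse[OF A(2,1)] by blast
  hence "A \<in> Units (ring_mat TYPE(complex) n ())"
    using A unfolding Units_def by (auto simp: ring_mat_def)
  then obtain C where "mat_inverse A = Some C"
    using mat_inverse(1)[OF A(1), where b = "()"] by (cases "mat_inverse A") auto
  from mat_inverse(2)[OF A(1) this] show "mat_inv A \<in> carrier_mat n n"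
    "A * mat_inv A = 1\<^sub>m n" "mat_inv A * A = 1\<^sub>m n"
    unfolding mat_inv_def \<open>mat_inverse A = Some C\<close> by auto
qed

lemma mat_inv_eqI:
  assumes A: "A \<in> carrier_mat n n" and B: "B \<in> carrier_mat n n" and "A * B = 1\<^sub>m n" "B * A = 1\<^sub>m n"
  shows "mat_inv A = B"
proof -
  note inv = mat_inv[OF A invertible_matI[OF assms]]
  have "mat_inv A = mat_inv A * (A * B)" using inv assms by simp
  also have "\<dots> = B" using inv A B by (intro mult_mat_cancel_left[of _ _ n n]) auto
  finally show ?thesis .
qed

lemma invertible_mat_mult:
  fixes A B :: "complex mat"
  assumes A: "A \<in> carrier_mat n n" "invertible_mat A" and B: "B \<in> carrier_mat n n" "invertible_mat B"
  shows "invertible_mat (A * B)"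
proof -
  note iA = mat_inv[OF A] and iB = mat_inv[OF B]
  have "A * B * (mat_inv B * mat_inv A) = 1\<^sub>m n"
    using A(1) B(1) iA iB mult_mat_cancel_left[OF iB(2)] by (simp add: mult_mat_assoc_dim)
  moreover have "mat_inv B * mat_inv A * (A * B) = 1\<^sub>m n"
    using A(1) B(1) iA iB mult_mat_cancel_left[OF iA(3)] by (simp add: mult_mat_assoc_dim)
  ultimately show ?thesis
    using A(1) B(1) iA(1) iB(1)
    by (intro invertible_matI[of "A * B" n "mat_inv B * mat_inv A"]) auto
qed

text \<open>Expresses realness as a fixed-point equation under conjugation, so that a uniquely
  determined matrix is real as soon as its defining conditions are invariant under
  conjugation.\<close>

lemma mats_over_iff:
  assumes "K = \<real> \<or> K = UNIV"
  shows "A \<in> mats_over K m n \<longleftrightarrow> A \<in> carrier_mat m n \<and> (K = \<real> \<longrightarrow> conj_mat A = A)"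
proof -
  \<comment> \<open>This separates the two choices of \<open>K\<close>, so that the condition on
    conjugates is void for \<open>K = UNIV\<close>.\<close>
  have "\<i> \<notin> \<real>" by (simp add: complex_is_Real_iff)
  hence "(UNIV :: complex set) \<noteq> \<real>" by blast
  moreover have "elements_mat A \<subseteq> \<real> \<longleftrightarrow> conj_mat A = A"
  proof
    assume *: "elements_mat A \<subseteq> \<real>"
    show "conj_mat A = A"
    proof (rule eq_matI)
      fix i j assume "i < dim_row A" "j < dim_col A"
      thus "conj_mat A $$ (i, j) = A $$ (i, j)"
        using * elements_matI[of A "dim_row A" "dim_col A" i j]
        by (auto simp: conj_mat_def Reals_cnj_iff)
    qed (auto simp: conj_mat_def)
  next
    assume *: "conj_mat A = A"
    have "cnj (A $$ (i, j)) = A $$ (i, j)" if "i < dim_row A" "j < dim_col A" for i j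
      using that arg_cong[OF *, of "\<lambda>B. B $$ (i, j)"] by (simp add: conj_mat_def)
    thus "elements_mat A \<subseteq> \<real>" by (auto simp: Reals_cnj_iff dest!: elements_matD)
  qed
  ultimately show ?thesis using assms unfolding mats_over_def by auto
qed

lemma mats_over_carrier: "A \<in> mats_over K m n \<Longrightarrow> A \<in> carrier_mat m n"
  by (simp add: mats_over_def)

lemma mats_over_mult:
  assumes K: "K = \<real> \<or> K = UNIV" and "A \<in> mats_over K m k" "B \<in> mats_over K k n"
  shows "A * B \<in> mats_over K m n"
  using assms conj_mat_mult[of A m k B n] unfolding mats_over_iff[OF K] by auto

lemma mats_over_conj_mat:
  assumes K: "K = \<real> \<or> K = UNIV" and "A \<in> mats_over K m n"
  shows "conj_mat A \<in> mats_over K m n"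
  using assms unfolding mats_over_iff[OF K] by simp

text \<open>In the real case the conjugate of the inverse is again an inverse of \<open>A\<close>,
  hence equal to it.\<close>

lemma mats_over_mat_inv:
  assumes K: "K = \<real> \<or> K = UNIV" and A: "A \<in> mats_over K n n" "invertible_mat A"
  shows "mat_inv A \<in> mats_over K n n"
proof -
  have Ac: "A \<in> carrier_mat n n" using A(1) by (rule mats_over_carrier)
  note inv = mat_inv[OF Ac A(2)]
  have "conj_mat (mat_inv A) = mat_inv A" if "K = \<real>"
  proof -
    have "conj_mat A = A" using A(1) that unfolding mats_over_iff[OF K] by simp
    hence "A * conj_mat (mat_inv A) = 1\<^sub>m n" "conj_mat (mat_inv A) * A = 1\<^sub>m n"
      using arg_cong[OF inv(2), of conj_mat] arg_cong[OF inv(3), of conj_mat]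
      unfolding conj_mat_mult[OF Ac inv(1)] conj_mat_mult[OF inv(1) Ac] conj_mat_one by simp_all
    thus ?thesis using mat_inv_eqI[OF Ac, of "conj_mat (mat_inv A)"] inv by simp
  qed
  thus ?thesis using inv unfolding mats_over_iff[OF K] by simp
qed

lemma mats_over_adjoint:
  assumes K: "K = \<real> \<or> K = UNIV" and M: "M \<in> mats_over K m m"
    and N: "N \<in> mats_over K n n" "invertible_mat N" and F: "F \<in> mats_over K m n"
  shows "adjoint s M N F \<in> mats_over K n m"
proof -
  have "sharp s F \<in> mats_over K n m"
    using F unfolding mats_over_iff[OF K] by (simp add: conj_mat_sharp)
  thus ?thesis
    unfolding adjoint_def using mats_over_mult[OF K] mats_over_mat_inv[OF K N] M by blast
qed

section \<open>Selfadjointness, double adjoints and Gram matrices\<close>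

lemma selfadjoint_iff:
  assumes M: "M \<in> carrier_mat m m" "invertible_mat M" and A: "A \<in> carrier_mat m m"
  shows "selfadjoint s M A \<longleftrightarrow> sharp s A * M = M * A"
proof -
  note iM = mat_inv[OF M]
  have "M * adjoint s M M A = sharp s A * M"
    unfolding adjoint_def using A M(1) iM(1) mult_mat_cancel_left[OF iM(2) M(1) iM(1)]
    by (simp add: mult_mat_assoc_dim)
  moreover have "adjoint s M M A = mat_inv M * (sharp s A * M)"
    unfolding adjoint_def using A M(1) iM(1) by (simp add: mult_mat_assoc_dim)
  moreover have "mat_inv M * (M * A) = A"
    using A M(1) iM by (intro mult_mat_cancel_left[of _ _ m m]) auto
  ultimately show ?thesis unfolding selfadjoint_def by auto
qed

lemma selfadjoint_mat_inv:
  assumes M: "M \<in> carrier_mat m m" "invertible_mat M" and S: "S \<in> carrier_mat m m" "invertible_mat S"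
    and "selfadjoint s M S"
  shows "selfadjoint s M (mat_inv S)"
proof -
  note iS = mat_inv[OF S]
  have sS: "sharp s S * M = M * S" using assms selfadjoint_iff[OF M S(1)] by simp
  have 1: "sharp s (mat_inv S) * sharp s S = 1\<^sub>m m"
    using sharp_mult[OF S(1) iS(1), of s] iS(2) by simp
  have "sharp s (mat_inv S) * M = sharp s (mat_inv S) * (M * S * mat_inv S)"
    using M(1) S(1) iS by (simp add: mult_mat_assoc_dim)
  also have "\<dots> = M * mat_inv S"
    unfolding sS[symmetric] using M(1) S(1) iS(1) mult_mat_cancel_left[OF 1]
    by (simp add: mult_mat_assoc_dim)
  finally show ?thesis using selfadjoint_iff[OF M iS(1)] by simp
qed

text \<open>Here \<open>N\<^sup>-\<^sup>1 N\<^sup>#\<close> is the inverse of the factor \<open>(N\<^sup>-\<^sup>1)\<^sup># N\<close> occurring in the double adjoint.\<close>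

lemma double_adjoint_eq_iff:
  assumes M: "M \<in> carrier_mat m m" "invertible_mat M" and N: "N \<in> carrier_mat n n" "invertible_mat N"
    and F: "F \<in> carrier_mat m n"
  shows "adjoint s N M (adjoint s M N F) = F \<longleftrightarrow>
    sharp s M * F = M * (F * (mat_inv N * sharp s N))"
proof -
  note iM = mat_inv[OF M] and iN = mat_inv[OF N]
  let ?V = "sharp s (mat_inv N) * N" and ?V' = "mat_inv N * sharp s N"
  have V: "?V \<in> carrier_mat n n" "?V' \<in> carrier_mat n n" using N(1) iN(1) by auto
  have 2: "sharp s (mat_inv N) * sharp s N = 1\<^sub>m n"
    using sharp_mult[OF N(1) iN(1), of s] iN(2) by simp
  have VV': "?V * ?V' = 1\<^sub>m n"
    using N(1) iN(1) 2 mult_mat_cancel_left[OF iN(2)] by (simp add: mult_mat_assoc_dim)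
  hence V'V: "?V' * ?V = 1\<^sub>m n" by (rule mat_mult_left_right_inverse[OF V])
  have "sharp s (adjoint s M N F) = sharp s M * (F * sharp s (mat_inv N))"
    unfolding adjoint_def
    using M(1) iN(1) F by (simp add: sharp_mult[of _ n m _ m] sharp_mult[of _ n n _ m])
  hence eq: "adjoint s N M (adjoint s M N F) = mat_inv M * (sharp s M * F * ?V)"
    unfolding adjoint_def[of s N M] using M(1) iM(1) N(1) iN(1) F by (simp add: mult_mat_assoc_dim)
  show ?thesis
  proof
    assume "adjoint s N M (adjoint s M N F) = F"
    hence "M * (F * ?V') = M * (mat_inv M * (sharp s M * F * ?V)) * ?V'"
      using M(1) F V iM(1) unfolding eq by (simp add: mult_mat_assoc_dim)
    also have "M * (mat_inv M * (sharp s M * F * ?V)) = sharp s M * F * ?V"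
      using M(1) iM F by (intro mult_mat_cancel_left[of _ _ m m]) auto
    also have "sharp s M * F * ?V * ?V' = sharp s M * F * (?V * ?V')"
      using M(1) F V by (intro assoc_mult_mat[of _ m n _ n _ n]) auto
    finally show "sharp s M * F = M * (F * ?V')" unfolding VV' using M(1) F by simp
  next
    assume "sharp s M * F = M * (F * ?V')"
    hence "adjoint s N M (adjoint s M N F) = mat_inv M * (M * (F * ?V') * ?V)" unfolding eq by simp
    also have "M * (F * ?V') * ?V = M * (F * (?V' * ?V))"
      using M(1) F V by (simp add: assoc_mult_mat[of _ m m _ n _ n] assoc_mult_mat[of _ m n _ n _ n])
    also have "\<dots> = M * F" unfolding V'V using F by simp
    also have "mat_inv M * (M * F) = F"
      using M(1) iM F by (intro mult_mat_cancel_left[of _ _ m m]) auto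
    finally show "adjoint s N M (adjoint s M N F) = F" .
  qed
qed

text \<open>Applying \<open>sharp\<close> to \<open>sharp s S * M = M * S\<close> lets
  \<open>S\<close> pass \<open>sharp s M\<close> as well. The result serves both directions: for
  \<open>S * W\<close>, and for \<open>mat_inv S * F\<close>.\<close>

lemma double_adjoint_mult_selfadjoint:
  assumes M: "M \<in> carrier_mat m m" "invertible_mat M" and N: "N \<in> carrier_mat n n" "invertible_mat N"
    and F: "F \<in> carrier_mat m n" and S: "S \<in> carrier_mat m m" "selfadjoint s M S"
    and dF: "adjoint s N M (adjoint s M N F) = F"
  shows "adjoint s N M (adjoint s M N (S * F)) = S * F"
proof -
  note iN = mat_inv[OF N]
  let ?V' = "mat_inv N * sharp s N"
  have V': "?V' \<in> carrier_mat n n" using N(1) iN(1) by simp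
  have sS: "sharp s S * M = M * S" using S selfadjoint_iff[OF M] by simp
  have "sharp s M * S = sharp s S * sharp s M"
    using arg_cong[OF sS, of "sharp s"] M(1) S(1) by (simp add: sharp_mult[of _ m m _ m])
  hence "sharp s M * S * F = sharp s S * sharp s M * F" by simp
  hence "sharp s M * (S * F) = sharp s S * (sharp s M * F)"
    using M(1) S(1) F by (simp add: mult_mat_assoc_dim)
  also have "sharp s M * F = M * (F * ?V')" using dF double_adjoint_eq_iff[OF M N F] by simp
  also have "sharp s S * (M * (F * ?V')) = sharp s S * M * (F * ?V')"
    using M(1) S(1) F V' by (intro assoc_mult_mat[symmetric, of _ m m _ m _ n]) auto
  also have "\<dots> = M * (S * F * ?V')"
    unfolding sS using M(1) N(1) iN(1) S(1) F by (simp add: mult_mat_assoc_dim)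
  finally show ?thesis using double_adjoint_eq_iff[OF M N, of "S * F"] S F by simp
qed

text \<open>In the expansion of \<open>sharp s (F * adjoint s M N F)\<close> the double adjoint
  condition replaces \<open>sharp s M * F\<close> by a product ending in \<open>sharp s N\<close>,
  which cancels against \<open>sharp s (mat_inv N)\<close>.\<close>

lemma gram_selfadjoint:
  assumes M: "M \<in> carrier_mat m m" "invertible_mat M" and N: "N \<in> carrier_mat n n" "invertible_mat N"
    and F: "F \<in> carrier_mat m n" and dF: "adjoint s N M (adjoint s M N F) = F"
  shows "selfadjoint s M (F * adjoint s M N F)"
proof -
  note iN = mat_inv[OF N]
  have 1: "sharp s N * sharp s (mat_inv N) = 1\<^sub>m n"
    using sharp_mult[OF iN(1) N(1), of s] iN by simp
  have c: "F * adjoint s M N F \<in> carrier_mat m m"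
    unfolding adjoint_def using M(1) iN(1) F by simp
  have "sharp s (F * adjoint s M N F) = sharp s M * F * (sharp s (mat_inv N) * sharp s F)"
    unfolding adjoint_def using M(1) iN(1) F
    by (simp add: sharp_mult[of _ n m _ m] sharp_mult[of _ n n _ m] sharp_mult[of _ m n _ m] mult_mat_assoc_dim)
  also have "sharp s M * F = M * (F * (mat_inv N * sharp s N))"
    using dF double_adjoint_eq_iff[OF M N F] by simp
  also have "\<dots> * (sharp s (mat_inv N) * sharp s F) = M * (F * (mat_inv N * sharp s F))"
    using M(1) N(1) iN(1) F mult_mat_cancel_left[OF 1] by (simp add: mult_mat_assoc_dim)
  finally have "sharp s (F * adjoint s M N F) * M = M * (F * adjoint s M N F)"
    unfolding adjoint_def using M(1) iN(1) F by (simp add: mult_mat_assoc_dim)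
  thus ?thesis using selfadjoint_iff[OF M c] by simp
qed

text \<open>Selfadjointness moves \<open>S\<close> across \<open>M\<close>, so the adjoint of
  \<open>S * F\<close> is the adjoint of \<open>F\<close> followed by \<open>S\<close>.\<close>

lemma gram_mult_selfadjoint:
  assumes M: "M \<in> carrier_mat m m" "invertible_mat M" and N: "N \<in> carrier_mat n n" "invertible_mat N"
    and F: "F \<in> carrier_mat m n" and S: "S \<in> carrier_mat m m" "selfadjoint s M S"
  shows "(S * F) * adjoint s M N (S * F) = S * (F * adjoint s M N F) * S"
proof -
  note iN = mat_inv[OF N]
  have sS: "sharp s S * M = M * S" using S selfadjoint_iff[OF M] by simp
  have "adjoint s M N (S * F) = mat_inv N * sharp s F * (sharp s S * M)"
    unfolding adjoint_def sharp_mult[OF S(1) F]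
    using M(1) iN(1) F S(1) by (simp add: mult_mat_assoc_dim)
  thus ?thesis
    unfolding sS adjoint_def using M(1) iN(1) F S(1) by (simp add: mult_mat_assoc_dim)
qed

subsection \<open>The polar decomposition\<close>

lemma generalized_matrix_sign_value:
  assumes K: "K = \<real> \<or> K = UNIV" and \<sigma>: "generalized_matrix_sign_function K m \<sigma>"
    and A: "A \<in> mats_over K m m" and val: "\<sigma> A = Some \<Sigma>"
  shows "invertible_mat A" "\<Sigma> \<in> mats_over K m m" "invertible_mat \<Sigma>"
    "\<And>x :: real. x < 0 \<Longrightarrow> \<not> eigenvalue (\<Sigma> * A) (complex_of_real x)"
    "\<Sigma> * A = A * \<Sigma>"
    "M \<in> mats_over K m m \<Longrightarrow> invertible_mat M \<Longrightarrow> selfadjoint s M A \<Longrightarrow> selfadjoint s M \<Sigma>"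
proof -
  obtain f where f0: "f 0 = None"
    and f: "\<And>A B. A \<in> mats_over K m m \<Longrightarrow> \<sigma> A = Some B \<longleftrightarrow> has_matfun_value f A B"
    using \<sigma> unfolding generalized_matrix_sign_function_def primary_matrix_function_def by blast
  have fA: "has_matfun_value f A \<Sigma>" by (rule f[OF A, THEN iffD1, OF val])
  have Ac: "A \<in> carrier_mat m m" using A by (rule mats_over_carrier)
  show iA: "invertible_mat A" by (rule has_matfun_value_invertible[OF fA f0 Ac])
  obtain B where "\<sigma> A = Some B" "B \<in> mats_over K m m"
      "\<And>x :: real. x < 0 \<Longrightarrow> \<not> eigenvalue (B * A) (complex_of_real x)"
      "\<sigma> (conj_mat A) = Some (conj_mat B)" "\<And>z. eigenvalue B z \<Longrightarrow> cmod z = 1"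
    using \<sigma> A iA unfolding generalized_matrix_sign_function_def by blast
  moreover have "B = \<Sigma>" using \<open>\<sigma> A = Some B\<close> val by simp
  ultimately have B: "\<Sigma> \<in> mats_over K m m"
    "\<And>x :: real. x < 0 \<Longrightarrow> \<not> eigenvalue (\<Sigma> * A) (complex_of_real x)"
    "\<sigma> (conj_mat A) = Some (conj_mat \<Sigma>)" "\<And>z. eigenvalue \<Sigma> z \<Longrightarrow> cmod z = 1"
    by simp_all
  note \<Sigma> = B(1) and conj = B(3) and mod = B(4)
  show "\<Sigma> \<in> mats_over K m m" by (rule B(1))
  show "\<And>x :: real. x < 0 \<Longrightarrow> \<not> eigenvalue (\<Sigma> * A) (complex_of_real x)" by (rule B(2))
  have \<Sigma>c: "\<Sigma> \<in> carrier_mat m m" using \<Sigma> by (rule mats_over_carrier)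
  have "\<not> eigenvalue \<Sigma> 0" using mod[of 0] by auto
  thus "invertible_mat \<Sigma>" by (rule invertible_mat_if_no_zero_eigenvalue[OF \<Sigma>c])
  \<comment> \<open>Uniqueness of the stem value is inherited from \<sigma> being a function,
    without comparing Jordan decompositions.\<close>
  have unique: "B = \<Sigma>" if "has_matfun_value f A B" for B
    using f[OF A, THEN iffD2, OF that] val by simp
  note inv = mat_inv[OF Ac iA]
  have "A * A * mat_inv A = A"
    using Ac inv by (simp add: assoc_mult_mat[of _ m m _ m _ m])
  hence "has_matfun_value f A (A * \<Sigma> * mat_inv A)"
    using has_matfun_value_conjugate[OF fA Ac Ac inv] by simp
  from unique[OF this] have "\<Sigma> * A = A * \<Sigma> * mat_inv A * A" by simp
  also have "\<dots> = A * \<Sigma>" using Ac \<Sigma>c inv by (simp add: assoc_mult_mat[of _ m m _ m _ m])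
  finally show "\<Sigma> * A = A * \<Sigma>" .
  have sharp: "has_matfun_value f (sharp s A) (sharp s \<Sigma>)"
  proof (cases s)
    case Bilinear
    thus ?thesis using has_matfun_value_transpose[OF fA] by simp
  next
    \<comment> \<open>Here the compatibility of \<sigma> with complex conjugation enters, in
      addition to transposition.\<close>
    case Sesquilinear
    have "has_matfun_value f (conj_mat A) (conj_mat \<Sigma>)"
      using conj f[OF mats_over_conj_mat[OF K A]] by simp
    thus ?thesis using has_matfun_value_transpose Sesquilinear by simp
  qed
  show "selfadjoint s M \<Sigma>" if "M \<in> mats_over K m m" "invertible_mat M" "selfadjoint s M A"
  proof -
    have M: "M \<in> carrier_mat m m" using that(1) by (rule mats_over_carrier)
    note iM = mat_inv[OF M that(2)]
    have "has_matfun_value f (adjoint s M M A) (adjoint s M M \<Sigma>)"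
      unfolding adjoint_def using Ac
      by (intro has_matfun_value_conjugate[OF sharp _ iM(1) M iM(3,2)]) simp
    hence "has_matfun_value f A (adjoint s M M \<Sigma>)" using that(3) unfolding selfadjoint_def by simp
    thus ?thesis unfolding selfadjoint_def by (rule unique)
  qed
qed

text \<open>Both square roots of a nonpositive real number are purely imaginary, and one of them
  would have to be an eigenvalue of \<open>S\<close>.\<close>

lemma no_nonpos_eigenvalue_square:
  assumes S: "S \<in> carrier_mat n n" "r_positive_definite S" and "x \<le> 0"
  shows "\<not> eigenvalue (S * S) (complex_of_real x)"
proof
  let ?c = "\<i> * complex_of_real (sqrt (- x))"
  assume "eigenvalue (S * S) (complex_of_real x)"
  moreover have "?c\<^sup>2 = complex_of_real x"
    using \<open>x \<le> 0\<close> by (simp add: power_mult_distrib flip: of_real_power)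
  ultimately have "eigenvalue S ?c \<or> eigenvalue S (- ?c)" using eigenvalue_square[OF S(1)] by metis
  thus False using S(2) unfolding r_positive_definite_def by force
qed

lemma principal_sqrt_eqI:
  assumes S: "S \<in> carrier_mat n n" "r_positive_definite S"
  shows "principal_sqrt (S * S) = S"
  unfolding principal_sqrt_def
proof (rule the_equality)
  show "S \<in> carrier_mat (dim_row (S * S)) (dim_row (S * S)) \<and> S * S = S * S \<and>
      (\<forall>z. eigenvalue S z \<longrightarrow> Re z > 0)"
    using S unfolding r_positive_definite_def by auto
next
  fix X assume *: "X \<in> carrier_mat (dim_row (S * S)) (dim_row (S * S)) \<and> X * X = S * S \<and>
      (\<forall>z. eigenvalue X z \<longrightarrow> Re z > 0)"
  hence X: "X \<in> carrier_mat n n" using S(1) by auto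
  thus "X = S"
    using right_half_plane_sqrt_unique[OF X S(1)] * S(2) unfolding r_positive_definite_def by auto
qed

section \<open>Necessity and sufficiency of the conditions on F\<close>

lemma generalized_polar_decomposition_square:
  assumes K: "K = \<real> \<or> K = UNIV"
    and M: "M \<in> mats_over K m m" "invertible_mat M" and N: "N \<in> mats_over K n n" "invertible_mat N"
    and \<sigma>: "generalized_matrix_sign_function K m \<sigma>" and F: "F \<in> mats_over K m n"
    and dec: "generalized_polar_decomposition K s m n M N \<sigma> F \<Sigma> S W"
  shows "\<Sigma> * (F * adjoint s M N F) = S * S" "S \<in> carrier_mat m m" "r_positive_definite S"
    "invertible_mat S" "W = mat_inv S * F" "invertible_mat (F * adjoint s M N F)"
    "adjoint s N M (adjoint s M N F) = F"
proof -
  note Mc = mats_over_carrier[OF M(1)] and Nc = mats_over_carrier[OF N(1)]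
  from dec have val: "\<sigma> (F * adjoint s M N F) = Some \<Sigma>" and FSW: "F = S * W"
    and S: "S \<in> mats_over K m m" and rS: "r_positive_definite S" and saM: "selfadjoint s M S"
    and saMS: "selfadjoint s (M * \<Sigma>) S" and W: "W \<in> mats_over K m n"
    and oW: "orthonormal_rows s (M * \<Sigma>) N W" and dW: "adjoint s N M (adjoint s M N W) = W"
    unfolding generalized_polar_decomposition_def by auto
  show Sc: "S \<in> carrier_mat m m" using S by (rule mats_over_carrier)
  have Wc: "W \<in> carrier_mat m n" using W by (rule mats_over_carrier)
  show "r_positive_definite S" by (rule rS)
  hence "\<not> eigenvalue S 0" unfolding r_positive_definite_def by force
  thus iS: "invertible_mat S" by (rule invertible_mat_if_no_zero_eigenvalue[OF Sc])
  show "W = mat_inv S * F"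
    unfolding FSW using mat_inv[OF Sc iS] Sc Wc by (intro mult_mat_cancel_left[symmetric, of _ _ m m]) auto
  have A: "F * adjoint s M N F \<in> mats_over K m m"
    using mats_over_mult[OF K F mats_over_adjoint[OF K M(1) N F]] .
  note sign = generalized_matrix_sign_value[OF K \<sigma> A val]
  show "invertible_mat (F * adjoint s M N F)" by (rule sign)
  show "adjoint s N M (adjoint s M N F) = F"
    unfolding FSW by (rule double_adjoint_mult_selfadjoint[OF Mc M(2) Nc N(2) Wc Sc saM dW])
  have \<Sigma>c: "\<Sigma> \<in> carrier_mat m m" using sign(2) by (rule mats_over_carrier)
  have M\<Sigma>: "M * \<Sigma> \<in> carrier_mat m m" "invertible_mat (M * \<Sigma>)"
    using Mc \<Sigma>c invertible_mat_mult[OF Mc M(2) \<Sigma>c sign(3)] by auto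
  note iM = mat_inv[OF Mc M(2)] and iN = mat_inv[OF Nc N(2)]
  \<comment> \<open>Evaluating \<open>sharp s S * M * \<Sigma>\<close> by selfadjointness for
    \<open>M\<close> and for \<open>M * \<Sigma>\<close> and cancelling \<open>M\<close> shows that
    \<open>S\<close> and \<Sigma> commute.\<close>
  have "M * (S * \<Sigma>) = sharp s S * M * \<Sigma>"
    using saM selfadjoint_iff[OF Mc M(2) Sc] Mc Sc \<Sigma>c by (simp add: assoc_mult_mat[of _ m m _ m _ m])
  also have "\<dots> = M * (\<Sigma> * S)"
    using saMS selfadjoint_iff[OF M\<Sigma> Sc] Mc Sc \<Sigma>c by (simp add: assoc_mult_mat[of _ m m _ m _ m])
  finally have "mat_inv M * (M * (S * \<Sigma>)) = mat_inv M * (M * (\<Sigma> * S))" by simp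
  hence comm: "S * \<Sigma> = \<Sigma> * S"
    using mult_mat_cancel_left[OF iM(3) iM(1) Mc] Sc \<Sigma>c by simp
  \<comment> \<open>Orthonormality of the rows of \<open>W\<close> says
    \<open>?G * \<Sigma> = 1\<close>; for square matrices this is also a left inverse relation for
    \<Sigma>, and so \<open>?G\<close> disappears from
    \<open>\<Sigma> * (S * ?G * S)\<close>.\<close>
  let ?G = "W * adjoint s M N W"
  have G: "?G \<in> carrier_mat m m" unfolding adjoint_def using Mc iN(1) Wc by simp
  have "?G * \<Sigma> = W * adjoint s (M * \<Sigma>) N W"
    unfolding adjoint_def using Mc iN(1) Wc \<Sigma>c by (simp add: mult_mat_assoc_dim)
  also have "\<dots> = 1\<^sub>m m" using oW Wc unfolding orthonormal_rows_def by simp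
  finally have "\<Sigma> * ?G = 1\<^sub>m m" by (rule mat_mult_left_right_inverse[OF G \<Sigma>c])
  have "\<Sigma> * (F * adjoint s M N F) = \<Sigma> * (S * ?G * S)"
    unfolding FSW gram_mult_selfadjoint[OF Mc M(2) Nc N(2) Wc Sc saM] ..
  also have "\<dots> = \<Sigma> * S * ?G * S" using \<Sigma>c Sc G by (simp add: assoc_mult_mat[of _ m m _ m _ m])
  also have "\<dots> = S * (\<Sigma> * ?G) * S"
    unfolding comm[symmetric] using \<Sigma>c Sc G by (simp add: assoc_mult_mat[of _ m m _ m _ m])
  also have "\<dots> = S * S" unfolding \<open>\<Sigma> * ?G = 1\<^sub>m m\<close> using Sc by simp
  finally show "\<Sigma> * (F * adjoint s M N F) = S * S" .
qed

lemma generalized_polar_decomposition_exists: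
  assumes K: "K = \<real> \<or> K = UNIV"
    and M: "M \<in> mats_over K m m" "invertible_mat M" and N: "N \<in> mats_over K n n" "invertible_mat N"
    and \<sigma>: "generalized_matrix_sign_function K m \<sigma>" and F: "F \<in> mats_over K m n"
    and inv: "invertible_mat (F * adjoint s M N F)" and dF: "adjoint s N M (adjoint s M N F) = F"
  shows "\<exists>\<Sigma> S W. generalized_polar_decomposition K s m n M N \<sigma> F \<Sigma> S W"
proof -
  note Mc = mats_over_carrier[OF M(1)] and Nc = mats_over_carrier[OF N(1)]
    and Fc = mats_over_carrier[OF F]
  note iM = mat_inv[OF Mc M(2)] and iN = mat_inv[OF Nc N(2)]
  define A where "A = F * adjoint s M N F"
  have A: "A \<in> mats_over K m m"
    unfolding A_def using mats_over_mult[OF K F mats_over_adjoint[OF K M(1) N F]] .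
  hence Ac: "A \<in> carrier_mat m m" by (rule mats_over_carrier)
  have saA: "selfadjoint s M A" unfolding A_def by (rule gram_selfadjoint[OF Mc M(2) Nc N(2) Fc dF])
  have invA: "invertible_mat A" using inv unfolding A_def .
  obtain \<Sigma> where val: "\<sigma> A = Some \<Sigma>"
    using \<sigma> A invA unfolding generalized_matrix_sign_function_def by blast
  note sign = generalized_matrix_sign_value[OF K \<sigma> A val]
  have \<Sigma>c: "\<Sigma> \<in> carrier_mat m m" using sign(2) by (rule mats_over_carrier)
  note i\<Sigma> = mat_inv[OF \<Sigma>c sign(3)]
  have sa\<Sigma>: "selfadjoint s M \<Sigma>" by (rule sign(6)[OF M saA])
  define B where "B = \<Sigma> * A"
  have B: "B \<in> mats_over K m m" unfolding B_def by (rule mats_over_mult[OF K sign(2) A])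
  hence Bc: "B \<in> carrier_mat m m" by (rule mats_over_carrier)
  \<comment> \<open>Zero is excluded by invertibility, the negative reals by the defining property
    of the sign function.\<close>
  have "\<not> eigenvalue B (complex_of_real x)" if "x \<le> 0" for x
  proof (cases "x = 0")
    case True
    have "invertible_mat B" unfolding B_def by (rule invertible_mat_mult[OF \<Sigma>c sign(3) Ac invA])
    thus ?thesis using no_zero_eigenvalue_if_invertible_mat[OF Bc] True by simp
  next
    case False
    thus ?thesis using that sign(4)[of x] unfolding B_def by simp
  qed
  then obtain S where Sc: "S \<in> carrier_mat m m" and SS: "S * S = B" and rS: "r_positive_definite S"
    using right_half_plane_sqrt_exists[OF Bc] by blast
  have root_unique: "X = S" if "X \<in> carrier_mat m m" "X * X = B" "r_positive_definite X" for X
    using right_half_plane_sqrt_unique[OF that(1) Sc _ that(3) rS] that(2) SS by simp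
  \<comment> \<open>For real data \<open>B\<close> is fixed by conjugation, so the conjugate of
    \<open>S\<close> is another admissible root of \<open>B\<close>.\<close>
  have "conj_mat S = S" if "K = \<real>"
  proof (rule root_unique)
    show "conj_mat S * conj_mat S = B"
      using B that unfolding mats_over_iff[OF K] conj_mat_mult[OF Sc Sc, symmetric] SS by simp
  qed (use Sc r_positive_definite_conj_mat[OF Sc rS] in auto)
  hence S: "S \<in> mats_over K m m" using Sc unfolding mats_over_iff[OF K] by simp
  \<comment> \<open>Used twice: with \<open>P = mat_inv \<Sigma>\<close> and \<open>X = S\<close> it
    yields commutation with \<Sigma>, and with \<open>P = mat_inv M\<close> and
    \<open>X = sharp s S\<close> it yields selfadjointness for \<open>M\<close>.\<close>
  have root_conjugate: "P * X * Q = S"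
    if "P \<in> carrier_mat m m" "Q \<in> carrier_mat m m" "P * Q = 1\<^sub>m m" "Q * P = 1\<^sub>m m"
      "X \<in> carrier_mat m m" "r_positive_definite X" "P * (X * X) * Q = B" for P Q X
  proof (rule root_unique)
    show "P * X * Q * (P * X * Q) = B"
      using that(1,2,5,7) mult_mat_cancel_left[OF that(4) that(2) that(1)]
      by (simp add: mult_mat_assoc_dim)
    show "r_positive_definite (P * X * Q)"
      using that(1-6) by (intro r_positive_definite_similar[OF similar_mat_wit_conjugate[of _ m]])
  qed (use that(1,2,5) in simp)
  have "mat_inv \<Sigma> * S * \<Sigma> = S"
  proof (rule root_conjugate[OF i\<Sigma>(1) \<Sigma>c i\<Sigma>(3,2) Sc rS])
    have "mat_inv \<Sigma> * B * \<Sigma> = A * \<Sigma>"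
      unfolding B_def using \<Sigma>c Ac i\<Sigma>(1) mult_mat_cancel_left[OF i\<Sigma>(3)] by (simp add: mult_mat_assoc_dim)
    thus "mat_inv \<Sigma> * (S * S) * \<Sigma> = B" unfolding SS using sign(5) B_def by simp
  qed
  hence "\<Sigma> * S = \<Sigma> * (mat_inv \<Sigma> * (S * \<Sigma>))"
    using \<Sigma>c Sc i\<Sigma>(1) by (simp add: mult_mat_assoc_dim)
  also have "\<dots> = S * \<Sigma>" using \<Sigma>c Sc i\<Sigma> by (intro mult_mat_cancel_left[of _ _ m m]) auto
  finally have comm: "\<Sigma> * S = S * \<Sigma>" .
  have saM: "selfadjoint s M S"
    unfolding selfadjoint_def adjoint_def
  proof (rule root_conjugate[OF iM(1) Mc iM(3,2)])
    have 1: "sharp s \<Sigma> * M = M * \<Sigma>" and 2: "sharp s A * M = M * A"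
      using sa\<Sigma> saA selfadjoint_iff[OF Mc M(2)] \<Sigma>c Ac by auto
    have "sharp s B * M = sharp s A * (sharp s \<Sigma> * M)"
      unfolding B_def sharp_mult[OF \<Sigma>c Ac] using \<Sigma>c Ac Mc by (simp add: assoc_mult_mat[of _ m m _ m _ m])
    also have "\<dots> = sharp s A * M * \<Sigma>"
      unfolding 1 using \<Sigma>c Ac Mc by (simp add: assoc_mult_mat[of _ m m _ m _ m])
    also have "\<dots> = M * B"
      unfolding 2 B_def sign(5) using \<Sigma>c Ac Mc
      by (simp add: assoc_mult_mat[of _ m m _ m _ m])
    finally have "selfadjoint s M B" using selfadjoint_iff[OF Mc M(2) Bc] by simp
    thus "mat_inv M * (sharp s S * sharp s S) * M = B"
      unfolding sharp_mult[OF Sc Sc, symmetric] SS unfolding selfadjoint_def adjoint_def .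
  qed (use Sc r_positive_definite_sharp[OF Sc rS] in auto)
  have M\<Sigma>: "M * \<Sigma> \<in> carrier_mat m m" "invertible_mat (M * \<Sigma>)"
    using Mc \<Sigma>c invertible_mat_mult[OF Mc M(2) \<Sigma>c sign(3)] by auto
  have "sharp s S * (M * \<Sigma>) = M * \<Sigma> * S"
  proof -
    have "sharp s S * (M * \<Sigma>) = sharp s S * M * \<Sigma>"
      using Sc Mc \<Sigma>c by (simp add: mult_mat_assoc_dim)
    also have "sharp s S * M = M * S" using saM selfadjoint_iff[OF Mc M(2) Sc] by blast
    also have "M * S * \<Sigma> = M * (\<Sigma> * S)" unfolding comm using Sc Mc \<Sigma>c by (simp add: mult_mat_assoc_dim)
    also have "\<dots> = M * \<Sigma> * S" using Sc Mc \<Sigma>c by (simp add: mult_mat_assoc_dim)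
    finally show ?thesis .
  qed
  hence saMS: "selfadjoint s (M * \<Sigma>) S" using selfadjoint_iff[OF M\<Sigma> Sc] by simp
  have "\<not> eigenvalue S 0" using rS unfolding r_positive_definite_def by force
  hence invS: "invertible_mat S" by (rule invertible_mat_if_no_zero_eigenvalue[OF Sc])
  note iS = mat_inv[OF Sc invS]
  define W where "W = mat_inv S * F"
  have W: "W \<in> mats_over K m n"
    unfolding W_def by (rule mats_over_mult[OF K mats_over_mat_inv[OF K S invS] F])
  hence Wc: "W \<in> carrier_mat m n" by (rule mats_over_carrier)
  have sa_iS: "selfadjoint s M (mat_inv S)" by (rule selfadjoint_mat_inv[OF Mc M(2) Sc invS saM])
  have FSW: "F = S * W"
    unfolding W_def using Fc Sc iS by (intro mult_mat_cancel_left[symmetric, of _ _ m m]) auto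
  have dW: "adjoint s N M (adjoint s M N W) = W"
    unfolding W_def by (rule double_adjoint_mult_selfadjoint[OF Mc M(2) Nc N(2) Fc iS(1) sa_iS dF])
  have "mat_inv S * \<Sigma> = mat_inv S * (\<Sigma> * S) * mat_inv S"
    using Sc iS \<Sigma>c by (simp add: assoc_mult_mat[of _ m m _ m _ m])
  also have "\<dots> = \<Sigma> * mat_inv S"
    unfolding comm using Sc iS(1) \<Sigma>c mult_mat_cancel_left[OF iS(3) iS(1) Sc]
    by (simp add: mult_mat_assoc_dim)
  finally have comm': "mat_inv S * \<Sigma> = \<Sigma> * mat_inv S" .
  \<comment> \<open>The Gram matrix of \<open>W\<close> is \<open>mat_inv S * A * mat_inv S\<close>;
    moving \<Sigma> next to \<open>A\<close> produces \<open>A * \<Sigma> = S * S\<close>, which the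
    outer inverses cancel.\<close>
  have "W * adjoint s (M * \<Sigma>) N W = W * adjoint s M N W * \<Sigma>"
    unfolding adjoint_def using Mc iN(1) Wc \<Sigma>c by (simp add: mult_mat_assoc_dim)
  also have "W * adjoint s M N W = mat_inv S * A * mat_inv S"
    unfolding W_def A_def by (rule gram_mult_selfadjoint[OF Mc M(2) Nc N(2) Fc iS(1) sa_iS])
  also have "\<dots> * \<Sigma> = mat_inv S * (A * (mat_inv S * \<Sigma>))"
    using Ac \<Sigma>c iS(1) by (simp add: assoc_mult_mat[of _ m m _ m _ m])
  also have "\<dots> = mat_inv S * (A * \<Sigma>) * mat_inv S"
    unfolding comm' using Ac \<Sigma>c iS(1) by (simp add: assoc_mult_mat[of _ m m _ m _ m])
  also have "A * \<Sigma> = S * S" using SS sign(5) B_def by simp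
  also have "mat_inv S * (S * S) * mat_inv S = 1\<^sub>m m"
    using Sc iS(1,2) mult_mat_cancel_left[OF iS(3) iS(1) Sc] by (simp add: mult_mat_assoc_dim)
  finally have oW: "orthonormal_rows s (M * \<Sigma>) N W" unfolding orthonormal_rows_def using Wc by simp
  have "generalized_polar_decomposition K s m n M N \<sigma> F \<Sigma> S W"
    unfolding generalized_polar_decomposition_def
    by (intro conjI val[unfolded A_def] FSW S rS saM saMS W oW dW)
  thus ?thesis by blast
qed

theorem theorem5p2:
  fixes K :: "complex set" and s :: form_kind and m n :: nat
    and M N F :: "complex mat" and \<sigma> :: "complex mat \<Rightarrow> complex mat option"
  assumes "K = \<real> \<or> K = UNIV"
    and "m \<le> n"
    and "M \<in> mats_over K m m" and "invertible_mat M"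
    and "N \<in> mats_over K n n" and "invertible_mat N"
    and "generalized_matrix_sign_function K m \<sigma>"
    and "F \<in> mats_over K m n"
  shows "((\<exists>\<Sigma> S W. generalized_polar_decomposition K s m n M N \<sigma> F \<Sigma> S W) \<longleftrightarrow>
          invertible_mat (F * adjoint s M N F) \<and> adjoint s N M (adjoint s M N F) = F) \<and>
         (\<forall>\<Sigma> S W \<Sigma>' S' W'.
            generalized_polar_decomposition K s m n M N \<sigma> F \<Sigma> S W \<longrightarrow>
            generalized_polar_decomposition K s m n M N \<sigma> F \<Sigma>' S' W' \<longrightarrow>
            S = S' \<and> W = W') \<and>
         (\<forall>\<Sigma> S W. generalized_polar_decomposition K s m n M N \<sigma> F \<Sigma> S W \<longrightarrow>
            (\<forall>x::real. x \<le> 0 \<longrightarrow>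
               \<not> eigenvalue (\<Sigma> * (F * adjoint s M N F)) (complex_of_real x)) \<and>
            S = principal_sqrt (\<Sigma> * (F * adjoint s M N F)) \<and>
            invertible_mat S \<and> W = mat_inv S * F)"
proof (intro conjI iffI allI impI)
  note square = generalized_polar_decomposition_square[OF assms(1,3-8)]
  let ?A = "F * adjoint s M N F"
  {
    assume "\<exists>\<Sigma> S W. generalized_polar_decomposition K s m n M N \<sigma> F \<Sigma> S W"
    thus "invertible_mat ?A" "adjoint s N M (adjoint s M N F) = F" using square(6,7) by blast+
  }
  show "\<exists>\<Sigma> S W. generalized_polar_decomposition K s m n M N \<sigma> F \<Sigma> S W"
    if "invertible_mat ?A \<and> adjoint s N M (adjoint s M N F) = F"
    using that generalized_polar_decomposition_exists[OF assms(1,3-8)] by blast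
  fix \<Sigma> S W assume dec: "generalized_polar_decomposition K s m n M N \<sigma> F \<Sigma> S W"
  note sq = square[OF dec]
  show "\<not> eigenvalue (\<Sigma> * ?A) (complex_of_real x)" if "x \<le> 0" for x
    unfolding sq(1) using that by (rule no_nonpos_eigenvalue_square[OF sq(2,3)])
  show "S = principal_sqrt (\<Sigma> * ?A)" unfolding sq(1) principal_sqrt_eqI[OF sq(2,3)] ..
  show "invertible_mat S" "W = mat_inv S * F" by (rule sq)+
  fix \<Sigma>' S' W' assume dec': "generalized_polar_decomposition K s m n M N \<sigma> F \<Sigma>' S' W'"
  note sq' = square[OF dec']
  \<comment> \<open>Both sign factors are the value of \<sigma> at the same matrix, so
    \<open>S\<close> and \<open>S'\<close> are right half-plane roots of one matrix.\<close>
  have "\<sigma> ?A = Some \<Sigma>" "\<sigma> ?A = Some \<Sigma>'"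
    using dec dec' unfolding generalized_polar_decomposition_def by blast+
  hence "\<Sigma> = \<Sigma>'" by simp
  hence "S * S = S' * S'" using sq(1) sq'(1) by simp
  thus "S = S'" by (rule right_half_plane_sqrt_unique[OF sq(2) sq'(2) _ sq(3) sq'(3)])
  thus "W = W'" using sq(5) sq'(5) by simp
qed

end
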